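(* Let $n\ge2$ and let $X,Y\in M(n,\mathbb{C})$ be nonzero matrices. Then $(X,Y)$ is maximal if and only if there exists a unitary matrix $U\in U(n)$ such that $$X=U\operatorname{diag}(X_0,0)U^*\quad\text{and}\quad Y=U\operatorname{diag}(Y_0,0)U^*$$ with a maximal pair $(X_0,Y_0)$ in $M(2,\mathbb{C})$, i.e. with nonzero $X_0,Y_0\in M(2,\mathbb{C})$ satisfying $\operatorname{Tr}(X_0Y_0^* )=0$ and $\operatorname{Tr}X_0=\operatorname{Tr}Y_0=0$.
   Context: $M(n,\mathbb{C})$ is the space of complex $n\times n$ matrices and $\|X\|=\sqrt{\operatorname{Tr}XX^*}$ is the Frobenius norm, $X^*$ the conjugate transpose. A pair $(X,Y)$ of matrices in $M(n,\mathbb{C})$ is called maximal if $X\ne O$, $Y\ne O$ and $\|XY-YX\|^2=2\|X\|^2\|Y\|^2$. *)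

theory Defs
  imports "Jordan_Normal_Form.Schur_Decomposition"
begin

definition mat_trace :: "'a::comm_monoid_add mat \<Rightarrow> 'a" where
  "mat_trace A = (\<Sum>i<dim_row A. A $$ (i, i))"

(* Tr(A A^* ) is a nonnegative real, see mat_trace_mult_mat_adjoint below; Re only changes the type. *)
definition frobenius_norm :: "complex mat \<Rightarrow> real" where
  "frobenius_norm A = sqrt (Re (mat_trace (A * mat_adjoint A)))"

definition unitary_group :: "nat \<Rightarrow> complex mat set" where
  "unitary_group n = {U \<in> carrier_mat n n. U * mat_adjoint U = 1\<^sub>m n \<and> mat_adjoint U * U = 1\<^sub>m n}"

definition maximal_pair :: "nat \<Rightarrow> complex mat \<Rightarrow> complex mat \<Rightarrow> bool" where
  "maximal_pair n X Y \<longleftrightarrow> X \<in> carrier_mat n n \<and> Y \<in> carrier_mat n n \<and>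
     X \<noteq> 0\<^sub>m n n \<and> Y \<noteq> 0\<^sub>m n n \<and>
     (frobenius_norm (X * Y - Y * X))\<^sup>2 = 2 * (frobenius_norm X)\<^sup>2 * (frobenius_norm Y)\<^sup>2"

lemma mat_trace_mult_mat_adjoint:
  "mat_trace (A * mat_adjoint A) =
     of_real (\<Sum>i<dim_row A. \<Sum>j<dim_col A. (cmod (A $$ (i, j)))\<^sup>2)"
  by (auto simp: mat_trace_def mat_adjoint_def scalar_prod_def mat_of_rows_def
      complex_norm_square lessThan_atLeast0 simp del: of_real_power intro!: sum.cong)

end

theory Submission
  imports Defs "Jordan_Normal_Form.Spectral_Radius"
begin

text \<open>
  Write \<open>fsq A\<close> for the squared Frobenius norm and \<open>[X, Y] = X Y - Y X\<close>. The bound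
  \<open>fsq [X, Y] \<le> 2 fsq X fsq Y\<close> is the Boettcher--Wenzel inequality; maximal pairs are those
  where equality holds. The inequality is proved by an argument of Lu that can be followed
  backwards in the case of equality.

  Fix \<open>X\<close> and consider the ratio \<open>fsq [X, W] / fsq W\<close>. The matrix \<open>adj [X, Y]\<close> is orthogonal to \<open>Y\<close>, and on
  the pencil that the two span the ratio is at least its value at \<open>Y\<close>
  (\<open>fsq_pencil\<close>, \<open>fsq_comm_adj_comm_ge\<close>). So \<open>Y\<close> may be replaced by any nonzero member of a
  two-dimensional space, which leaves room to impose one linear condition. Let \<open>X = U S adj V\<close> be a singular value
  decomposition with singular values \<open>s i\<close>, and let \<open>b = adj V W V\<close> and \<open>c = adj U W U\<close>. Then
  \<open>fsq [X, W]\<close> is the sum of \<open>\<bar>s i b i j - s j c i j\<bar>\<^sup>2\<close>, and each term is at most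
  \<open>((s i)\<^sup>2 + (s j)\<^sup>2) (\<bar>b i j\<bar>\<^sup>2 + \<bar>c i j\<bar>\<^sup>2)\<close>. The first factor is at most \<open>fsq X\<close>, except possibly at
  \<open>i = j = k\<close> for the largest singular value \<open>s k\<close>; there the condition \<open>b k k = c k k\<close> makes the term vanish.
  Summation gives the inequality (\<open>boettcher_wenzel\<close>).

  For a maximal pair all these estimates are sharp. On the one hand
  \<open>[X, adj [X, Y]]\<close> is a multiple of \<open>adj Y\<close> (\<open>maximal_pencil\<close>), so that \<open>Y\<close> can be recovered from \<open>X\<close> and any nonzero
  \<open>W\<close> of the pencil. On the other hand the entries of \<open>b\<close> and \<open>c\<close> vanish unless
  \<open>(s i)\<^sup>2 + (s j)\<^sup>2 = fsq X\<close>, which forces \<open>X\<close> and \<open>W\<close> to live on a common space of dimension at most two.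
  How this space arises depends on the singular values: two equal
  ones (\<open>small_top_support\<close>), two distinct nonzero ones (\<open>rank_two_support\<close>), or a single one
  (\<open>rank_one_support\<close>). A unitary basis that starts with that space brings both matrices
  into corner form (\<open>supported_to_corner\<close>).

  In dimension two the traceless matrices form a copy of \<open>\<complex>\<^sup>3\<close> in which the commutator is, up to a factor,
  the cross product. Lagrange's identity then shows that maximality means
  vanishing traces and orthogonality (\<open>maximal_pair_2_iff\<close>).
\<close>

section \<open>Adjoint, trace and Frobenius norm\<close>

abbreviation adj :: "complex mat \<Rightarrow> complex mat" where "adj \<equiv> mat_adjoint"

abbreviation fsq :: "complex mat \<Rightarrow> real" where "fsq A \<equiv> (frobenius_norm A)\<^sup>2"

abbreviation comm :: "complex mat \<Rightarrow> complex mat \<Rightarrow> complex mat" where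
  "comm X Y \<equiv> X * Y - Y * X"

lemma dim_adj [simp]: "dim_row (adj A) = dim_col A" "dim_col (adj A) = dim_row A"
  by (auto simp: mat_adjoint_def mat_of_rows_def)

lemma index_adj [simp]: "i < dim_col A \<Longrightarrow> j < dim_row A \<Longrightarrow> adj A $$ (i, j) = cnj (A $$ (j, i))"
  by (simp add: mat_adjoint_def mat_of_rows_def)

lemma adj_carrier [simp]: "A \<in> carrier_mat n m \<Longrightarrow> adj A \<in> carrier_mat m n"
  by (intro carrier_matI) auto

lemma adj_adj [simp]: "adj (adj A) = A"
  by (rule eq_matI) auto

lemma adj_mult: "A \<in> carrier_mat n m \<Longrightarrow> B \<in> carrier_mat m k \<Longrightarrow> adj (A * B) = adj B * adj A"
  by (rule eq_matI) (auto simp: scalar_prod_def mult.commute)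

lemma adj_add: "A \<in> carrier_mat n m \<Longrightarrow> B \<in> carrier_mat n m \<Longrightarrow> adj (A + B) = adj A + adj B"
  by (rule eq_matI) auto

lemma adj_minus: "A \<in> carrier_mat n m \<Longrightarrow> B \<in> carrier_mat n m \<Longrightarrow> adj (A - B) = adj A - adj B"
  by (rule eq_matI) auto

lemma adj_smult [simp]: "adj (c \<cdot>\<^sub>m A) = cnj c \<cdot>\<^sub>m adj A"
  by (rule eq_matI) auto

lemma adj_one [simp]: "adj (1\<^sub>m n) = 1\<^sub>m n"
  by (rule eq_matI) auto

lemma adj_zero [simp]: "adj (0\<^sub>m n m) = 0\<^sub>m m n"
  by (rule eq_matI) auto

lemma smult_smult_mat: "a \<cdot>\<^sub>m (b \<cdot>\<^sub>m A) = (a * b) \<cdot>\<^sub>m A" for A :: "complex mat"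
  by (rule eq_matI) auto

lemma one_smult_mat [simp]: "1 \<cdot>\<^sub>m A = A" for A :: "complex mat"
  by (rule eq_matI) auto

lemma fsq_sum: "fsq A = (\<Sum>i<dim_row A. \<Sum>j<dim_col A. (cmod (A $$ (i, j)))\<^sup>2)"
  unfolding frobenius_norm_def mat_trace_mult_mat_adjoint
  by (simp add: sum_nonneg del: of_real_sum of_real_power)

lemma trace_mult_adj: "mat_trace (A * adj A) = of_real (fsq A)"
  unfolding fsq_sum by (rule mat_trace_mult_mat_adjoint)

lemma trace_add: "A \<in> carrier_mat n n \<Longrightarrow> B \<in> carrier_mat n n \<Longrightarrow>
    mat_trace (A + B) = mat_trace A + mat_trace B"
  by (simp add: mat_trace_def sum.distrib)

lemma trace_minus: "A \<in> carrier_mat n n \<Longrightarrow> B \<in> carrier_mat n n \<Longrightarrow>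
    mat_trace (A - B) = (mat_trace A - mat_trace B :: complex)"
  by (simp add: mat_trace_def sum_subtractf)

lemma trace_smult: "A \<in> carrier_mat n n \<Longrightarrow> mat_trace (c \<cdot>\<^sub>m A) = (c * mat_trace A :: complex)"
  by (simp add: mat_trace_def sum_distrib_left)

lemma trace_adj: "A \<in> carrier_mat n n \<Longrightarrow> mat_trace (adj A) = cnj (mat_trace A)"
  by (simp add: mat_trace_def)

lemma mult_entry_sum: "A \<in> carrier_mat n m \<Longrightarrow> B \<in> carrier_mat m k \<Longrightarrow> i < n \<Longrightarrow> j < k \<Longrightarrow>
    (A * B) $$ (i, j) = (\<Sum>l<m. A $$ (i, l) * B $$ (l, j))"
  by (simp add: scalar_prod_def lessThan_atLeast0)

lemma trace_mult_sum: "A \<in> carrier_mat n m \<Longrightarrow> B \<in> carrier_mat m n \<Longrightarrow>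
    mat_trace (A * B) = (\<Sum>i<n. \<Sum>j<m. A $$ (i, j) * B $$ (j, i) :: complex)"
  by (simp add: mat_trace_def scalar_prod_def lessThan_atLeast0)

lemma trace_comm: "A \<in> carrier_mat n m \<Longrightarrow> B \<in> carrier_mat m n \<Longrightarrow>
    mat_trace (A * B) = (mat_trace (B * A) :: complex)"
  unfolding trace_mult_sum[of A n m B] trace_mult_sum[of B m n A]
  by (subst sum.swap) (simp only: mult.commute)

lemma fsq_nonneg: "fsq A \<ge> 0" by simp

lemma fsq_eq_0_iff:
  assumes A: "A \<in> carrier_mat n m"
  shows "fsq A = 0 \<longleftrightarrow> A = 0\<^sub>m n m"
proof
  assume "fsq A = 0"
  then have "\<forall>i\<in>{..<n}. (\<Sum>j<m. (cmod (A $$ (i, j)))\<^sup>2) = 0"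
    using A unfolding fsq_sum by (subst (asm) sum_nonneg_eq_0_iff) (auto intro: sum_nonneg)
  then have "\<forall>i\<in>{..<n}. \<forall>j\<in>{..<m}. (cmod (A $$ (i, j)))\<^sup>2 = 0"
    by (subst (asm) sum_nonneg_eq_0_iff) auto
  then show "A = 0\<^sub>m n m" using A by (intro eq_matI) auto
next
  assume "A = 0\<^sub>m n m"
  then show "fsq A = 0" by (simp add: fsq_sum del: power_eq_0_iff)
qed

lemma fsq_pos_iff: "A \<in> carrier_mat n m \<Longrightarrow> fsq A > 0 \<longleftrightarrow> A \<noteq> 0\<^sub>m n m"
  using fsq_eq_0_iff[of A n m] by (metis less_le zero_le_power2)

lemma fsq_adj [simp]: "fsq (adj A) = fsq A"
  unfolding fsq_sum by (subst sum.swap) simp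

section \<open>The commutator on the pencil of Y and the adjoint of [X, Y]\<close>

context
  fixes n :: nat
begin

lemma sq_carrier [simp]:
  "A \<in> carrier_mat n n \<Longrightarrow> B \<in> carrier_mat n n \<Longrightarrow> A * B \<in> carrier_mat n n"
  "A \<in> carrier_mat n n \<Longrightarrow> B \<in> carrier_mat n n \<Longrightarrow> A + B \<in> carrier_mat n n"
  "A \<in> carrier_mat n n \<Longrightarrow> B \<in> carrier_mat n n \<Longrightarrow> A - B \<in> carrier_mat n n"
  for A B :: "complex mat"
  by auto

lemma sq_mult_three:
  "A * B * C = A * (B * C)"
  "A * (B + C) = A * B + A * C" "(A + B) * C = A * C + B * C"
  "A * (B - C) = A * B - A * C" "(A - B) * C = A * C - B * C"
  if "A \<in> carrier_mat n n" "B \<in> carrier_mat n n" "C \<in> carrier_mat n n"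
  for A B C :: "complex mat"
  using that
  by (auto simp: add_mult_distrib_mat mult_add_distrib_mat minus_mult_distrib_mat
      mult_minus_distrib_mat)

lemma sq_mult_two:
  "(a \<cdot>\<^sub>m A) * B = a \<cdot>\<^sub>m (A * B)" "A * (a \<cdot>\<^sub>m B) = a \<cdot>\<^sub>m (A * B)"
  "adj (A * B) = adj B * adj A" "adj (A + B) = adj A + adj B" "adj (A - B) = adj A - adj B"
  if "A \<in> carrier_mat n n" "B \<in> carrier_mat n n"
  for A B :: "complex mat"
  using that by (auto simp: adj_mult adj_add adj_minus)

lemmas sq_algebra = sq_mult_three sq_mult_two

lemma sq_trace:
  "mat_trace (A + B) = mat_trace A + mat_trace B"
  "mat_trace (A - B) = mat_trace A - mat_trace B"
  if "A \<in> carrier_mat n n" "B \<in> carrier_mat n n" for A B :: "complex mat"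
  using that by (auto simp: trace_add trace_minus)

lemma sq_trace_cyclic:
  "A \<in> carrier_mat n n \<Longrightarrow> B \<in> carrier_mat n n \<Longrightarrow> C \<in> carrier_mat n n \<Longrightarrow>
    mat_trace (A * (B * C)) = mat_trace (B * (C * A))" for A B C :: "complex mat"
  using trace_comm[of A n n "B * C"] by (simp add: sq_algebra)

lemma fsq_lincomb:
  assumes A: "A \<in> carrier_mat n n" and B: "B \<in> carrier_mat n n"
  shows "fsq (a \<cdot>\<^sub>m A + b \<cdot>\<^sub>m B) =
    (cmod a)\<^sup>2 * fsq A + (cmod b)\<^sup>2 * fsq B + 2 * Re (a * cnj b * mat_trace (A * adj B))"
proof -
  have "(cmod (a * x + b * y))\<^sup>2 = (cmod a)\<^sup>2 * (cmod x)\<^sup>2 + (cmod b)\<^sup>2 * (cmod y)\<^sup>2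
      + 2 * Re (a * cnj b * (x * cnj y))" for x y
    unfolding cmod_power2 by (simp add: algebra_simps power2_eq_square)
  note expand = this
  have "2 * Re (a * cnj b * mat_trace (A * adj B)) =
      (\<Sum>i<n. \<Sum>j<n. 2 * Re (a * cnj b * (A $$ (i, j) * cnj (B $$ (i, j)))))"
    using A B by (simp add: trace_mult_sum[of _ n n] sum_distrib_left del: times_complex.sel)
  then show ?thesis
    using A B by (simp add: fsq_sum expand sum.distrib sum_distrib_left del: times_complex.sel)
qed

lemma comm_lincomb:
  assumes "X \<in> carrier_mat n n" "A \<in> carrier_mat n n" "B \<in> carrier_mat n n"
  shows "comm X (a \<cdot>\<^sub>m A + b \<cdot>\<^sub>m B) = a \<cdot>\<^sub>m comm X A + b \<cdot>\<^sub>m comm X B"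
  using assms by (intro eq_matI) (auto simp add: sq_algebra algebra_simps simp del: index_mult_mat(1))

text \<open>Cyclicity of the trace gives \<open>Tr (X A A) = Tr (A X A)\<close>. For \<open>A = Y\<close> this says that \<open>Y\<close> is
  orthogonal to \<open>adj [X, Y]\<close>, and for \<open>A = adj [X, Y]\<close> that \<open>[X, Y]\<close> is orthogonal to
  \<open>[X, adj [X, Y]]\<close>.\<close>

lemma trace_comm_mult_self:
  assumes "X \<in> carrier_mat n n" "A \<in> carrier_mat n n"
  shows "mat_trace (comm X A * A) = 0"
  using assms sq_trace_cyclic[of A X A] by (simp add: sq_algebra sq_trace)

text \<open>Cyclicity moves the bracket with \<open>X\<close> from \<open>adj Z\<close> to \<open>Y\<close>, where \<open>Z = [X, Y]\<close>; what remains is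
  \<open>- Tr (adj Z Z)\<close>.\<close>

lemma trace_comm_adj_comm:
  assumes "X \<in> carrier_mat n n" "Y \<in> carrier_mat n n"
  shows "mat_trace (comm X (adj (comm X Y)) * Y) = - of_real (fsq (comm X Y))"
proof -
  define Z where "Z = comm X Y"
  have Z: "Z \<in> carrier_mat n n" using assms by (simp add: Z_def)
  have "mat_trace (comm X (adj Z) * Y) = mat_trace (adj Z * (Y * X)) - mat_trace (adj Z * (X * Y))"
    using assms Z sq_trace_cyclic[of X "adj Z" Y] by (simp add: sq_algebra sq_trace)
  also have "\<dots> = - mat_trace (adj Z * Z)"
    using assms Z by (subst (3) Z_def) (simp add: sq_algebra sq_trace)
  also have "\<dots> = - mat_trace (Z * adj Z)" using Z by (subst trace_comm[of _ n n]) auto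
  finally show ?thesis unfolding trace_mult_adj Z_def .
qed

text \<open>Pythagoras on the pencil spanned by \<open>Y\<close> and \<open>adj [X, Y]\<close>: both these two matrices and their
  brackets with \<open>X\<close> are orthogonal.\<close>

lemma fsq_pencil:
  assumes XY: "X \<in> carrier_mat n n" "Y \<in> carrier_mat n n"
  shows "fsq (a \<cdot>\<^sub>m Y + b \<cdot>\<^sub>m adj (comm X Y)) = (cmod a)\<^sup>2 * fsq Y + (cmod b)\<^sup>2 * fsq (comm X Y)"
    and "fsq (comm X (a \<cdot>\<^sub>m Y + b \<cdot>\<^sub>m adj (comm X Y))) =
      (cmod a)\<^sup>2 * fsq (comm X Y) + (cmod b)\<^sup>2 * fsq (comm X (adj (comm X Y)))"
proof -
  define Z where "Z = comm X Y"
  have Z: "Z \<in> carrier_mat n n" using assms by (simp add: Z_def)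
  have "mat_trace (Y * Z) = 0"
    using trace_comm_mult_self[OF XY] trace_comm[of Y n n Z] XY Z unfolding Z_def by simp
  then show "fsq (a \<cdot>\<^sub>m Y + b \<cdot>\<^sub>m adj (comm X Y)) = (cmod a)\<^sup>2 * fsq Y + (cmod b)\<^sup>2 * fsq (comm X Y)"
    using XY Z fsq_lincomb[of Y "adj Z" a b] unfolding Z_def[symmetric] by simp
  have "mat_trace (Z * adj (comm X (adj Z))) = cnj (mat_trace (comm X (adj Z) * adj Z))"
    using XY Z trace_adj[of "comm X (adj Z) * adj Z" n] by (simp add: adj_mult[of _ n n _ n])
  also have "\<dots> = 0" using trace_comm_mult_self[of X "adj Z"] XY Z by simp
  finally show "fsq (comm X (a \<cdot>\<^sub>m Y + b \<cdot>\<^sub>m adj (comm X Y))) =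
      (cmod a)\<^sup>2 * fsq (comm X Y) + (cmod b)\<^sup>2 * fsq (comm X (adj (comm X Y)))"
    using XY Z fsq_lincomb[of Z "comm X (adj Z)" a b] comm_lincomb[of X Y "adj Z" a b]
    unfolding Z_def[symmetric] by simp
qed

lemma fsq_comm_adj_comm_plus:
  fixes s t :: real
  assumes XY: "X \<in> carrier_mat n n" "Y \<in> carrier_mat n n"
  shows "fsq (of_real s \<cdot>\<^sub>m comm X (adj (comm X Y)) + of_real t \<cdot>\<^sub>m adj Y) =
    s\<^sup>2 * fsq (comm X (adj (comm X Y))) + t\<^sup>2 * fsq Y - 2 * s * t * fsq (comm X Y)"
  using fsq_lincomb[of "comm X (adj (comm X Y))" "adj Y" "of_real s" "of_real t"]
    trace_comm_adj_comm[OF XY] XY by simp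

text \<open>This is the Cauchy--Schwarz inequality for \<open>[X, adj Z]\<close> and \<open>adj Y\<close>, where \<open>Z = [X, Y]\<close>. Read as
  \<open>fsq [X, adj Z] / fsq (adj Z) \<ge> fsq [X, Y] / fsq Y\<close>, it says that the relative size of the bracket
  with \<open>X\<close> does not drop from \<open>Y\<close> to \<open>adj Z\<close>, hence by \<open>fsq_pencil\<close> nowhere on the pencil
  that they span.\<close>

lemma fsq_comm_adj_comm_ge:
  assumes XY: "X \<in> carrier_mat n n" "Y \<in> carrier_mat n n"
  shows "(fsq (comm X Y))\<^sup>2 \<le> fsq (comm X (adj (comm X Y))) * fsq Y"
proof (cases "fsq Y = 0")
  case True
  then have "Y = 0\<^sub>m n n" using fsq_eq_0_iff[OF XY(2)] by blast
  then have "comm X Y = 0\<^sub>m n n" using XY by simp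
  then have "fsq (comm X Y) = 0" by (simp only: fsq_eq_0_iff[of _ n n] zero_carrier_mat)
  then show ?thesis by simp
next
  case False
  then have Y: "fsq Y > 0" using fsq_nonneg[of Y] by linarith
  define p q z where pqz: "p = fsq (comm X (adj (comm X Y)))" "q = fsq Y" "z = fsq (comm X Y)"
  \<comment> \<open>the squared norm of the combination of the two matrices that is orthogonal to \<open>adj Y\<close>\<close>
  have "0 \<le> q\<^sup>2 * p + z\<^sup>2 * q - 2 * q * z * z"
    using fsq_comm_adj_comm_plus[OF XY, of q z] unfolding pqz by (metis fsq_nonneg)
  also have "\<dots> = q * (p * q - z\<^sup>2)" by (simp add: power2_eq_square algebra_simps)
  finally show ?thesis using Y unfolding pqz[symmetric] by (simp add: zero_le_mult_iff)
qed

end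

section \<open>Singular value decomposition\<close>

lemma unitary_groupD:
  assumes "U \<in> unitary_group n"
  shows "U \<in> carrier_mat n n" "U * adj U = 1\<^sub>m n" "adj U * U = 1\<^sub>m n"
  using assms unfolding unitary_group_def by blast+

lemma unitary_groupI:
  assumes "U \<in> carrier_mat n n" "adj U * U = 1\<^sub>m n"
  shows "U \<in> unitary_group n"
  using assms mat_mult_left_right_inverse[OF adj_carrier[OF assms(1)] assms]
  unfolding unitary_group_def by blast

lemma unitary_mult:
  assumes U: "U \<in> unitary_group n" and V: "V \<in> unitary_group n"
  shows "U * V \<in> unitary_group n"
proof (rule unitary_groupI)
  note U' = unitary_groupD[OF U] and V' = unitary_groupD[OF V]
  have "adj (U * V) * (U * V) = adj V * ((adj U * U) * V)"
    using U'(1) V'(1) by (simp add: sq_algebra[of _ n])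
  also have "\<dots> = adj V * V" using V'(1) unfolding U'(3) by simp
  finally show "adj (U * V) * (U * V) = 1\<^sub>m n" using V'(3) by simp
  show "U * V \<in> carrier_mat n n" using U'(1) V'(1) by simp
qed

lemma fsq_smult [simp]: "fsq (c \<cdot>\<^sub>m A) = (cmod c)\<^sup>2 * fsq A"
  by (simp add: fsq_sum norm_mult power_mult_distrib sum_distrib_left)

text \<open>Vectors are represented by \<open>n \<times> 1\<close> matrices, so that the norm and trace lemmas for
  matrices apply to them.\<close>

lemma eigen_column:
  assumes C: "C \<in> carrier_mat n n" and n: "n > 0"
  obtains l v where "v \<in> carrier_mat n 1" "fsq v = 1" "C * v = l \<cdot>\<^sub>m v"
proof -
  obtain l x where lx: "eigenvector C x l"
    using spectrum_non_empty[OF C n] unfolding spectrum_def eigenvalue_def by blast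
  define w where "w = mat n 1 (\<lambda>(i, j). x $ i)"
  have w: "w \<in> carrier_mat n 1" by (simp add: w_def)
  have x: "x \<in> carrier_vec n" "x \<noteq> 0\<^sub>v n" "C *\<^sub>v x = l \<cdot>\<^sub>v x"
    using lx C by (auto simp: eigenvector_def)
  have Cw: "C * w = l \<cdot>\<^sub>m w"
  proof (rule eq_matI)
    fix i j assume ij: "i < dim_row (l \<cdot>\<^sub>m w)" "j < dim_col (l \<cdot>\<^sub>m w)"
    then have "(C * w) $$ (i, j) = (C *\<^sub>v x) $ i"
      using C x(1) by (simp add: w_def scalar_prod_def)
    also have "\<dots> = (l \<cdot>\<^sub>v x) $ i" by (simp only: x(3))
    also have "\<dots> = (l \<cdot>\<^sub>m w) $$ (i, j)" using ij x(1) by (simp add: w_def)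
    finally show "(C * w) $$ (i, j) = (l \<cdot>\<^sub>m w) $$ (i, j)" .
  qed (use C w in auto)
  have "w \<noteq> 0\<^sub>m n 1"
  proof
    assume w0: "w = 0\<^sub>m n 1"
    have "x = 0\<^sub>v n"
    proof (rule eq_vecI)
      fix i assume "i < dim_vec (0\<^sub>v n :: complex vec)"
      then show "x $ i = 0\<^sub>v n $ i" using arg_cong[OF w0, of "\<lambda>A. A $$ (i, 0)"] by (simp add: w_def)
    qed (use x in auto)
    with x show False by simp
  qed
  then have pos: "fsq w > 0" using fsq_pos_iff[OF w] by simp
  define v where "v = of_real (1 / sqrt (fsq w)) \<cdot>\<^sub>m w"
  show thesis
  proof (rule that)
    show "v \<in> carrier_mat n 1" using w by (simp add: v_def)
    show "fsq v = 1" using pos by (simp add: v_def power_divide del: of_real_divide)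
    show "C * v = l \<cdot>\<^sub>m v"
      unfolding v_def using Cw C w by (simp add: mult_smult_distrib[of _ n n] smult_smult_mat mult.commute)
  qed
qed

text \<open>An eigenvalue of \<open>adj A A\<close> with unit eigenvector \<open>v\<close> equals \<open>fsq (A v)\<close>, by taking the inner
  product with \<open>v\<close>; in particular it is a square of a nonnegative real.\<close>

lemma gram_eigen_column:
  assumes A: "A \<in> carrier_mat n n" and n: "n > 0"
  obtains s :: real and v where "v \<in> carrier_mat n 1" "fsq v = 1" "s \<ge> 0"
    "adj A * (A * v) = of_real (s\<^sup>2) \<cdot>\<^sub>m v" "fsq (A * v) = s\<^sup>2"
proof -
  have "adj A * A \<in> carrier_mat n n" using A by simp
  then obtain l v where v: "v \<in> carrier_mat n 1" "fsq v = 1" "(adj A * A) * v = l \<cdot>\<^sub>m v"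
    using eigen_column[OF _ n] by metis
  have l: "adj A * (A * v) = l \<cdot>\<^sub>m v"
    using v A assoc_mult_mat[of "adj A" n n A n v 1] by simp
  have "of_real (fsq (A * v)) = mat_trace ((A * v) * adj (A * v))" by (simp add: trace_mult_adj)
  also have "\<dots> = mat_trace (adj (A * v) * (A * v))"
    using A v by (intro trace_comm) auto
  also have "adj (A * v) * (A * v) = adj v * (adj A * (A * v))"
    using A v assoc_mult_mat[of "adj v" 1 n "adj A" n "A * v" 1] by (simp add: adj_mult[of A n n v 1])
  also have "\<dots> = l \<cdot>\<^sub>m (adj v * v)" using v unfolding l by (simp add: mult_smult_distrib[of _ 1 n])
  also have "mat_trace \<dots> = l * mat_trace (v * adj v)"
    using v by (subst trace_smult[of _ 1]) (auto intro!: trace_comm)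
  also have "\<dots> = l" using v by (simp add: trace_mult_adj)
  finally have ll: "l = of_real (fsq (A * v))" by simp
  show thesis
    by (rule that[of v "sqrt (fsq (A * v))"]) (use v l ll in auto)
qed

text \<open>A positive eigenvalue \<open>s\<^sup>2\<close> of \<open>adj A A\<close> yields the left vector \<open>A v / s\<close>, and symmetrically for
  \<open>A adj A\<close>. If an eigenvector \<open>v\<close> of the former and an eigenvector \<open>u\<close> of the latter both belong
  to the eigenvalue \<open>0\<close>, then they lie in the kernels of \<open>A\<close> and \<open>adj A\<close>, and
  form a pair with singular value \<open>0\<close>.\<close>

lemma singular_pair:
  assumes A: "A \<in> carrier_mat n n" and n: "n > 0"
  obtains s :: real and u v where "u \<in> carrier_mat n 1" "v \<in> carrier_mat n 1" "fsq u = 1" "fsq v = 1"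
    "s \<ge> 0" "A * v = of_real s \<cdot>\<^sub>m u" "adj A * u = of_real s \<cdot>\<^sub>m v"
proof -
  have pos: "\<exists>u. u \<in> carrier_mat n 1 \<and> fsq u = 1 \<and> A * v = of_real s \<cdot>\<^sub>m u \<and> adj A * u = of_real s \<cdot>\<^sub>m v"
    if "A \<in> carrier_mat n n" "v \<in> carrier_mat n 1" "s > 0"
      "adj A * (A * v) = of_real (s\<^sup>2) \<cdot>\<^sub>m v" "fsq (A * v) = s\<^sup>2" for A v and s :: real
  proof (intro exI conjI)
    let ?u = "of_real (1 / s) \<cdot>\<^sub>m (A * v)"
    have Av: "A * v \<in> carrier_mat n 1" using that by auto
    then show "?u \<in> carrier_mat n 1" by simp
    have "fsq ?u = (cmod (of_real (1 / s)))\<^sup>2 * s\<^sup>2" by (simp only: fsq_smult that(5))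
    also have "\<dots> = 1" using that(3) by (simp add: norm_divide power_divide)
    finally show "fsq ?u = 1" .
    show "A * v = of_real s \<cdot>\<^sub>m ?u" using that(3) by (simp add: smult_smult_mat)
    have "adj A * ?u = of_real (1 / s) \<cdot>\<^sub>m (adj A * (A * v))"
      using that(1) Av by (intro mult_smult_distrib[of _ n n]) auto
    then show "adj A * ?u = of_real s \<cdot>\<^sub>m v"
      unfolding that(4) using that(3) by (simp add: smult_smult_mat power2_eq_square)
  qed
  obtain s v where v: "v \<in> carrier_mat n 1" "fsq v = 1" "s \<ge> 0"
    "adj A * (A * v) = of_real (s\<^sup>2) \<cdot>\<^sub>m v" "fsq (A * v) = s\<^sup>2"
    using gram_eigen_column[OF A n] .
  obtain t u where u: "u \<in> carrier_mat n 1" "fsq u = 1" "t \<ge> 0"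
    "adj (adj A) * (adj A * u) = of_real (t\<^sup>2) \<cdot>\<^sub>m u" "fsq (adj A * u) = t\<^sup>2"
    using gram_eigen_column[of "adj A" n] A n by (metis adj_carrier)
  consider "s > 0" | "t > 0" | "s = 0" "t = 0" using v u by linarith
  then show thesis
  proof cases
    case 1
    then show thesis using pos[of A v s] A v that[of _ v s] by blast
  next
    case 2
    then show thesis using pos[of "adj A" u t] A u that[of u _ t] by auto
  next
    case 3
    have "A * v \<in> carrier_mat n 1" "adj A * u \<in> carrier_mat n 1"
      using A u v mult_carrier_mat[of "adj A" n n u 1] by auto
    then have "A * v = 0\<^sub>m n 1" "adj A * u = 0\<^sub>m n 1"
      using 3 u(5) v(5) fsq_eq_0_iff by fastforce+
    moreover have "0 \<cdot>\<^sub>m u = 0\<^sub>m n 1" "0 \<cdot>\<^sub>m v = 0\<^sub>m n 1" using u v by auto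
    ultimately show thesis using that[of u v 0] 3 A u v by simp
  qed
qed

lemma unitary_with_first_column:
  assumes v: "v \<in> carrier_mat n 1" "fsq v = 1"
  obtains U where "U \<in> unitary_group n" "\<And>i. i < n \<Longrightarrow> U $$ (i, 0) = v $$ (i, 0)"
proof -
  interpret cof_vec_space n "TYPE(complex)" .
  define x where "x = col v 0"
  have x: "x \<in> carrier_vec n" using v by (auto simp: x_def)
  have x0: "x \<noteq> 0\<^sub>v n"
  proof
    assume "x = 0\<^sub>v n"
    then have "v $$ (i, 0) = 0" if "i < n" for i
      using that v(1) \<open>x = 0\<^sub>v n\<close> index_col[of i v 0] by (simp add: x_def)
    with v have "fsq v = 0" by (simp add: fsq_sum del: power_eq_0_iff)
    with v show False by simp
  qed
  define ws where "ws = gram_schmidt n (basis_completion x)"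
  note bc = basis_completion[OF x x0]
  note gs = gram_schmidt_result[OF bc(2,4,5) ws_def]
  have len: "length ws = n" using gs(4) bc(6) by simp
  have n: "n > 0" using x x0 by (cases n) auto
  have hd: "ws ! 0 = x"
    using gram_schmidt_hd[OF x, of "tl (basis_completion x)"] bc(6,7) n len
    unfolding ws_def by (metis hd_Cons_tl hd_conv_nth length_0_conv less_numeral_extra(3))
  have carr: "ws ! i \<in> carrier_vec n" if "i < n" for i using gs(3) that len by auto
  define r where "r i = sqrt (\<Sum>k<n. (cmod (ws ! i $ k))\<^sup>2)" for i
  have self: "ws ! i \<bullet>c ws ! i = of_real ((r i)\<^sup>2)" if "i < n" for i
    using carr[OF that] unfolding r_def
    by (simp add: scalar_prod_def sum_nonneg complex_norm_square lessThan_atLeast0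
        del: of_real_power)
  have r: "r i \<noteq> 0" if "i < n" for i
    using gs(2) that len self[OF that] by (auto simp: corthogonal_def)
  define U where "U = mat n n (\<lambda>(i, j). ws ! j $ i / of_real (r j))"
  have "adj U * U = 1\<^sub>m n"
  proof (rule eq_matI)
    fix i j assume "i < dim_row (1\<^sub>m n :: complex mat)" "j < dim_col (1\<^sub>m n :: complex mat)"
    then have ij: "i < n" "j < n" by auto
    have "(adj U * U) $$ (i, j) = (ws ! j \<bullet>c ws ! i) / (of_real (r i) * of_real (r j))"
      using ij carr[OF ij(1)] carr[OF ij(2)]
      by (simp add: U_def scalar_prod_def sum_divide_distrib mult.commute)
    also have "\<dots> = 1\<^sub>m n $$ (i, j)"
    proof (cases "i = j")
      case True
      then show ?thesis using ij self r by (simp add: power2_eq_square)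
    next
      case False
      then show ?thesis using ij gs(2) len by (simp add: corthogonal_def)
    qed
    finally show "(adj U * U) $$ (i, j) = 1\<^sub>m n $$ (i, j)" .
  qed (auto simp: U_def)
  then have U: "U \<in> unitary_group n" by (intro unitary_groupI) (auto simp: U_def)
  have "r 0 = 1" using v hd n unfolding r_def fsq_sum by (simp add: x_def)
  then have "U $$ (i, 0) = v $$ (i, 0)" if "i < n" for i
    using that v hd n by (simp add: U_def x_def)
  with U that show thesis by blast
qed


text \<open>The direct sum of a \<open>1 \<times> 1\<close> block and a matrix.\<close>

definition border :: "complex \<Rightarrow> complex mat \<Rightarrow> complex mat" where
  "border a A =
    four_block_mat (mat 1 1 (\<lambda>_. a)) (0\<^sub>m 1 (dim_col A)) (0\<^sub>m (dim_row A) 1) A"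

lemma border_carrier [simp]: "A \<in> carrier_mat n m \<Longrightarrow> border a A \<in> carrier_mat (Suc n) (Suc m)"
  by (auto simp: border_def)

lemma border_mult:
  assumes A: "A \<in> carrier_mat n n" and B: "B \<in> carrier_mat n n"
  shows "border a A * border b B = border (a * b) (A * B)"
proof -
  have [simp]: "mat (Suc 0) (Suc 0) (\<lambda>_. a) * mat (Suc 0) (Suc 0) (\<lambda>_. b) =
      mat (Suc 0) (Suc 0) (\<lambda>_. a * b)"
    by (rule eq_matI) (auto simp: scalar_prod_def)
  have "A * B \<in> carrier_mat n n" using A B by simp
  with A B show ?thesis
    unfolding border_def
    by (subst mult_four_block_mat[of _ 1 1 _ n _ n _ _ 1 _ n]) auto
qed

lemma adj_border: "adj (border a A) = border (cnj a) (adj A)"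
  by (rule eq_matI) (auto simp: border_def)

lemma unitary_border:
  assumes U: "U \<in> unitary_group n"
  shows "border 1 U \<in> unitary_group (Suc n)"
proof (rule unitary_groupI)
  note U' = unitary_groupD[OF U]
  show "border 1 U \<in> carrier_mat (Suc n) (Suc n)" using U' by simp
  have "adj (border 1 U) * border 1 U = border 1 (1\<^sub>m n)"
    using U' by (simp add: adj_border border_mult[of _ n])
  also have "\<dots> = 1\<^sub>m (Suc n)" by (rule eq_matI) (auto simp: border_def)
  finally show "adj (border 1 U) * border 1 U = 1\<^sub>m (Suc n)" .
qed

text \<open>In unitary bases that start with \<open>u\<close> and \<open>v\<close>, the relation \<open>A v = s u\<close> fixes the first column of
  \<open>A\<close>. Applied to \<open>adj A\<close> as well, it fixes the first row.\<close>

lemma unitary_first_column_image: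
  assumes A: "A \<in> carrier_mat n n" and U: "U \<in> unitary_group n" and V: "V \<in> unitary_group n"
    and u: "u \<in> carrier_mat n 1" "\<And>i. i < n \<Longrightarrow> U $$ (i, 0) = u $$ (i, 0)"
    and v: "v \<in> carrier_mat n 1" "\<And>i. i < n \<Longrightarrow> V $$ (i, 0) = v $$ (i, 0)"
    and Av: "A * v = s \<cdot>\<^sub>m u" and i: "i < n"
  shows "(adj U * (A * V)) $$ (i, 0) = (if i = 0 then s else 0)"
proof -
  note U' = unitary_groupD[OF U] and V' = unitary_groupD[OF V]
  have AV: "(A * V) $$ (j, 0) = s * U $$ (j, 0)" if j: "j < n" for j
  proof -
    have "(A * V) $$ (j, 0) = (A * v) $$ (j, 0)"
      using j A V'(1) v by (simp add: scalar_prod_def)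
    then show ?thesis unfolding Av using j u by simp
  qed
  have "(adj U * (A * V)) $$ (i, 0) = s * (adj U * U) $$ (i, 0)"
    using i A U'(1) V'(1)
    by (simp add: mult_entry_sum[of "adj U" n n _ n] AV sum_distrib_left mult.left_commute
        del: index_mult_mat(1))
  then show ?thesis unfolding U'(3) using i by simp
qed

text \<open>A singular pair \<open>u, v\<close> splits off a \<open>1 \<times> 1\<close> block: in unitary bases starting with \<open>u\<close> and \<open>v\<close> the
  first row and column of \<open>A\<close> vanish off the diagonal, and induction handles the rest.\<close>

theorem singular_value_decomposition:
  assumes "A \<in> carrier_mat n n"
  obtains U V s where "U \<in> unitary_group n" "V \<in> unitary_group n" "\<And>i. s i \<ge> 0"
    "A = U * mat_diag n (\<lambda>i. of_real (s i)) * adj V"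
proof -
  have "\<exists>U V s. U \<in> unitary_group n \<and> V \<in> unitary_group n \<and> (\<forall>i. s i \<ge> 0) \<and>
    A = U * mat_diag n (\<lambda>i. of_real (s i)) * adj V"
    using assms
  proof (induction n arbitrary: A)
    case 0
    have "1\<^sub>m 0 \<in> unitary_group 0" by (rule unitary_groupI) auto
    moreover have "A = 1\<^sub>m 0 * mat_diag 0 (\<lambda>i. of_real 0) * adj (1\<^sub>m 0)"
      using 0 by (intro eq_matI) auto
    ultimately show ?case
      by (intro exI[of _ "1\<^sub>m 0"] exI[of _ "\<lambda>i. 0"] conjI) (assumption | simp)+
  next
    case (Suc n)
    note A = Suc.prems
    let ?E = "border 1"
    obtain s0 u v where uv: "u \<in> carrier_mat (Suc n) 1" "v \<in> carrier_mat (Suc n) 1"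
      "fsq u = 1" "fsq v = 1" "s0 \<ge> 0" "A * v = of_real s0 \<cdot>\<^sub>m u" "adj A * u = of_real s0 \<cdot>\<^sub>m v"
      using singular_pair[OF A] by blast
    obtain U where U: "U \<in> unitary_group (Suc n)" "\<And>i. i < Suc n \<Longrightarrow> U $$ (i, 0) = u $$ (i, 0)"
      using unitary_with_first_column[OF uv(1,3)] by blast
    obtain V where V: "V \<in> unitary_group (Suc n)" "\<And>i. i < Suc n \<Longrightarrow> V $$ (i, 0) = v $$ (i, 0)"
      using unitary_with_first_column[OF uv(2,4)] by blast
    note U' = unitary_groupD[OF U(1)] and V' = unitary_groupD[OF V(1)]
    define B where "B = adj U * (A * V)"
    have B: "B \<in> carrier_mat (Suc n) (Suc n)" using A U'(1) V'(1) by (simp add: B_def)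
    have col: "B $$ (i, 0) = (if i = 0 then of_real s0 else 0)" if "i < Suc n" for i
      unfolding B_def by (rule unitary_first_column_image[OF A U(1) V(1) uv(1) U(2) uv(2) V(2) uv(6) that])
    have row: "B $$ (0, j) = (if j = 0 then of_real s0 else 0)" if "j < Suc n" for j
    proof -
      have "adj B = adj V * (adj A * U)"
        using A U'(1) V'(1) by (simp add: B_def sq_algebra[of _ "Suc n"])
      then have "adj B $$ (j, 0) = (if j = 0 then of_real s0 else 0)"
        using unitary_first_column_image[OF _ V(1) U(1) uv(2) V(2) uv(1) U(2) uv(7) that] A by simp
      then show ?thesis using that B
        by (metis (no_types, lifting) carrier_matD complex_cnj_cancel_iff complex_cnj_complex_of_real
            complex_cnj_zero index_adj zero_less_Suc)
    qed
    define B' where "B' = mat n n (\<lambda>(i, j). B $$ (Suc i, Suc j))"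
    have "B' \<in> carrier_mat n n" by (simp add: B'_def)
    from Suc.IH[OF this] obtain U1 V1 s where IH: "U1 \<in> unitary_group n" "V1 \<in> unitary_group n"
      "\<And>i. s i \<ge> 0" "B' = U1 * mat_diag n (\<lambda>i. of_real (s i)) * adj V1" by blast
    note U1 = unitary_groupD[OF IH(1)] and V1 = unitary_groupD[OF IH(2)]
    let ?s = "case_nat s0 s"
    let ?D = "mat_diag (Suc n) (\<lambda>i. of_real (?s i)) :: complex mat"
    let ?S = "mat_diag n (\<lambda>i. of_real (s i)) :: complex mat"
    have "B = border (of_real s0) B'"
      using B by (intro eq_matI) (auto simp: col row B'_def border_def)
    also have "\<dots> = border 1 U1 * border (of_real s0) ?S * border 1 (adj V1)"
      using U1(1) V1(1) unfolding IH(4) by (simp add: border_mult[of _ n] del: assoc_mult_mat)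
    also have "border (of_real s0) ?S = ?D"
      by (intro eq_matI) (auto simp: mat_diag_def border_def split: nat.splits)
    also have "border 1 (adj V1) = adj (border 1 V1)" by (simp add: adj_border)
    finally have Beq: "B = ?E U1 * ?D * adj (?E V1)" .
    have EU: "?E U1 \<in> unitary_group (Suc n)" "?E V1 \<in> unitary_group (Suc n)"
      using IH unitary_border by auto
    note EU' = unitary_groupD(1)[OF EU(1)] unitary_groupD(1)[OF EU(2)]
    have D: "?D \<in> carrier_mat (Suc n) (Suc n)" by simp
    have "U * B * adj V = (U * adj U) * A * (V * adj V)"
      using A U'(1) V'(1) by (simp add: B_def sq_algebra[of _ "Suc n"])
    also have "\<dots> = A" using A unfolding U'(2) V'(2) by simp
    finally have "A = (U * ?E U1) * ?D * adj (V * ?E V1)"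
      using U'(1) V'(1) EU' D by (simp add: Beq sq_algebra[of _ "Suc n"] del: mat_diag_dim)
    moreover have "\<forall>i. ?s i \<ge> 0" using IH(3) uv(5) by (auto split: nat.splits)
    ultimately show ?case
      using unitary_mult[OF U(1) EU(1)] unitary_mult[OF V(1) EU(2)] by blast
  qed
  then show thesis using that by blast
qed

section \<open>The Boettcher--Wenzel inequality\<close>

lemma unitary_cancel:
  assumes U: "U \<in> unitary_group n" and A: "A \<in> carrier_mat n n"
  shows "adj U * (U * A) = A" "U * (adj U * A) = A"
proof -
  note U' = unitary_groupD[OF U]
  show "adj U * (U * A) = A"
    using sq_algebra(1)[of "adj U" n U A] U'(1,3) A by (metis adj_carrier left_mult_one_mat)
  show "U * (adj U * A) = A"
    using sq_algebra(1)[of U n "adj U" A] U'(1,2) A by (metis adj_carrier left_mult_one_mat)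
qed

lemma fsq_unitary_right:
  assumes U: "U \<in> unitary_group n" and A: "A \<in> carrier_mat n n"
  shows "fsq (A * U) = fsq A"
proof -
  have "complex_of_real (fsq (A * U)) = mat_trace ((A * U) * adj (A * U))" by (simp add: trace_mult_adj)
  also have "(A * U) * adj (A * U) = A * adj A"
    using A unitary_groupD(1)[OF U] by (simp add: sq_algebra[of _ n] unitary_cancel[OF U])
  finally show ?thesis unfolding trace_mult_adj by (simp only: of_real_eq_iff)
qed

lemma fsq_unitary_left:
  assumes U: "U \<in> unitary_group n" and A: "A \<in> carrier_mat n n"
  shows "fsq (U * A) = fsq A"
proof -
  have "adj U \<in> unitary_group n" using U by (auto simp add: unitary_group_def)
  then have "fsq (adj A * adj U) = fsq (adj A)" using A by (intro fsq_unitary_right) auto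
  then show ?thesis using A unitary_groupD(1)[OF U] by (simp flip: adj_mult[of _ n n _ n])
qed

lemma adj_unitary: "U \<in> unitary_group n \<Longrightarrow> adj U \<in> unitary_group n"
  by (auto simp add: unitary_group_def)

text \<open>The real matrix with rows \<open>(s, -t)\<close> and \<open>(t, s)\<close> is a rotation scaled by the square root of
  \<open>s\<^sup>2 + t\<^sup>2\<close>.\<close>

lemma norm_rotation:
  fixes s t :: real and b c :: complex
  shows "(cmod (of_real s * b - of_real t * c))\<^sup>2 + (cmod (of_real t * b + of_real s * c))\<^sup>2 =
    (s\<^sup>2 + t\<^sup>2) * ((cmod b)\<^sup>2 + (cmod c)\<^sup>2)"
  unfolding cmod_power2 by (simp add: algebra_simps power2_eq_square)

lemma weighted_difference_le:
  fixes s t S :: real and b c :: complex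
  assumes "s\<^sup>2 + t\<^sup>2 \<le> S"
  shows "(cmod (of_real s * b - of_real t * c))\<^sup>2 \<le> S * ((cmod b)\<^sup>2 + (cmod c)\<^sup>2)"
    and "(cmod (of_real s * b - of_real t * c))\<^sup>2 = S * ((cmod b)\<^sup>2 + (cmod c)\<^sup>2) \<Longrightarrow>
      of_real t * b + of_real s * c = 0 \<and> (b = 0 \<and> c = 0 \<or> s\<^sup>2 + t\<^sup>2 = S)"
proof -
  define P where "P = (cmod b)\<^sup>2 + (cmod c)\<^sup>2"
  define R where "R = (cmod (of_real t * b + of_real s * c))\<^sup>2"
  have id: "(cmod (of_real s * b - of_real t * c))\<^sup>2 + R = (s\<^sup>2 + t\<^sup>2) * P"
    unfolding P_def R_def by (rule norm_rotation)
  have le: "(s\<^sup>2 + t\<^sup>2) * P \<le> S * P" using assms by (intro mult_right_mono) (auto simp: P_def)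
  have R: "R \<ge> 0" by (simp add: R_def)
  show "(cmod (of_real s * b - of_real t * c))\<^sup>2 \<le> S * ((cmod b)\<^sup>2 + (cmod c)\<^sup>2)"
    using id le R unfolding P_def[symmetric] by linarith
  assume "(cmod (of_real s * b - of_real t * c))\<^sup>2 = S * ((cmod b)\<^sup>2 + (cmod c)\<^sup>2)"
  then have "R = 0" "(s\<^sup>2 + t\<^sup>2) * P = S * P" using id le R unfolding P_def[symmetric] by linarith+
  then have "of_real t * b + of_real s * c = 0" "s\<^sup>2 + t\<^sup>2 = S \<or> P = 0" by (auto simp: R_def)
  then show "of_real t * b + of_real s * c = 0 \<and> (b = 0 \<and> c = 0 \<or> s\<^sup>2 + t\<^sup>2 = S)"
    by (auto simp: P_def sum_power2_eq_zero_iff)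
qed

text \<open>A singular value decomposition of \<open>X\<close>. The values \<open>s\<close> are not sorted; \<open>k\<close> is the index of a
  largest one.\<close>

locale singular_values =
  fixes n :: nat and X U V :: "complex mat" and s :: "nat \<Rightarrow> real" and k :: nat
  assumes U: "U \<in> unitary_group n" and V: "V \<in> unitary_group n"
    and s_nonneg: "\<And>i. 0 \<le> s i"
    and X_svd: "X = U * mat_diag n (\<lambda>i. of_real (s i)) * adj V"
    and k: "k < n" and s_le: "\<And>i. i < n \<Longrightarrow> s i \<le> s k"
begin

abbreviation S :: "complex mat" where "S \<equiv> mat_diag n (\<lambda>i. of_real (s i))"

text \<open>The matrix of \<open>W\<close> in the basis of right, respectively left, singular vectors of \<open>X\<close>.\<close>

definition right_coords :: "complex mat \<Rightarrow> complex mat" where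
  "right_coords W = adj V * (W * V)"

definition left_coords :: "complex mat \<Rightarrow> complex mat" where
  "left_coords W = adj U * (W * U)"

lemma UV_carrier [simp]: "U \<in> carrier_mat n n" "V \<in> carrier_mat n n"
  using U V unitary_groupD by blast+

lemma X_carrier [simp]: "X \<in> carrier_mat n n" by (simp add: X_svd)

lemma coords_carrier [simp]: "W \<in> carrier_mat n n \<Longrightarrow> right_coords W \<in> carrier_mat n n"
  "W \<in> carrier_mat n n \<Longrightarrow> left_coords W \<in> carrier_mat n n"
  by (simp_all add: right_coords_def left_coords_def)

lemma coords_dim [simp]:
  "dim_row (right_coords W) = n" "dim_col (right_coords W) = n"
  "dim_row (left_coords W) = n" "dim_col (left_coords W) = n"
  using carrier_matD[OF UV_carrier(1)] carrier_matD[OF UV_carrier(2)]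
  by (simp_all add: right_coords_def left_coords_def)

lemma fsq_coords:
  "W \<in> carrier_mat n n \<Longrightarrow> fsq (right_coords W) = fsq W"
  "W \<in> carrier_mat n n \<Longrightarrow> fsq (left_coords W) = fsq W"
  by (simp_all add: right_coords_def left_coords_def fsq_unitary_left[of _ n] fsq_unitary_right[of _ n]
      adj_unitary U V)

lemma fsq_X: "fsq X = (\<Sum>i<n. (s i)\<^sup>2)"
proof -
  have "fsq X = fsq S"
    by (simp add: X_svd fsq_unitary_left[of _ n] fsq_unitary_right[of _ n] adj_unitary U V
        del: assoc_mult_mat)
  also have "\<dots> = (\<Sum>i<n. \<Sum>j<n. if i = j then (s i)\<^sup>2 else 0)"
    unfolding fsq_sum by (intro sum.cong) (auto simp: mat_diag_def)
  finally show ?thesis by simp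
qed

text \<open>In singular coordinates \<open>[X, W]\<close> becomes \<open>S b - c S\<close> with the diagonal matrix \<open>S\<close> of singular values,
  where \<open>b\<close> and \<open>c\<close> are the right and the left coordinates of \<open>W\<close>.\<close>

lemma fsq_comm_coords:
  assumes W: "W \<in> carrier_mat n n"
  shows "fsq (comm X W) = (\<Sum>i<n. \<Sum>j<n.
    (cmod (of_real (s i) * right_coords W $$ (i, j) - of_real (s j) * left_coords W $$ (i, j)))\<^sup>2)"
proof -
  have "fsq (comm X W) = fsq (adj U * (comm X W * V))"
    using W by (simp add: fsq_unitary_left[of _ n] fsq_unitary_right[of _ n] adj_unitary U V)
  also have "adj U * (comm X W * V) = S * right_coords W - left_coords W * S"
    using W V unitary_groupD(3)[OF V]
    by (simp add: right_coords_def left_coords_def X_svd sq_algebra[of _ n]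
        unitary_cancel[OF U] unitary_cancel[OF V] right_mult_one_mat[of S n n])
  also have "fsq \<dots> = (\<Sum>i<n. \<Sum>j<n.
    (cmod (of_real (s i) * right_coords W $$ (i, j) - of_real (s j) * left_coords W $$ (i, j)))\<^sup>2)"
    using W by (simp add: fsq_sum mat_diag_mult_left[of _ n n] mat_diag_mult_right[of _ n n] mult.commute)
  finally show ?thesis .
qed

lemma two_singular_values_le: "i < n \<Longrightarrow> j < n \<Longrightarrow> i \<noteq> j \<Longrightarrow> (s i)\<^sup>2 + (s j)\<^sup>2 \<le> fsq X"
  unfolding fsq_X using sum_mono2[of "{..<n}" "{i, j}" "\<lambda>i. (s i)\<^sup>2"] by simp

text \<open>The bound of \<open>weighted_difference_le\<close> with constant \<open>fsq X\<close> needs \<open>(s i)\<^sup>2 + (s j)\<^sup>2 \<le> fsq X\<close>. The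
  entry at \<open>(k, k)\<close> is the only one where this can fail, and it contributes nothing to
  the commutator if the two coordinates agree there.\<close>

definition balanced :: "complex mat \<Rightarrow> bool" where
  "balanced W \<longleftrightarrow> right_coords W $$ (k, k) = left_coords W $$ (k, k) \<or> 2 * (s k)\<^sup>2 \<le> fsq X"

lemma entry_weight_le:
  assumes "i < n" "j < n" "(i, j) \<noteq> (k, k) \<or> 2 * (s k)\<^sup>2 \<le> fsq X"
  shows "(s i)\<^sup>2 + (s j)\<^sup>2 \<le> fsq X"
proof (cases "i = j")
  case True
  have "(s i)\<^sup>2 \<le> (s k)\<^sup>2" using s_le[OF assms(1)] s_nonneg by (intro power_mono)
  then show ?thesis using True assms two_singular_values_le[of i k] k by fastforce
next
  case False
  then show ?thesis using assms two_singular_values_le by blast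
qed

lemma balanced_entry_le:
  fixes W i j
  defines "b \<equiv> right_coords W $$ (i, j)" and "c \<equiv> left_coords W $$ (i, j)"
  assumes "balanced W" "i < n" "j < n"
  shows "(cmod (of_real (s i) * b - of_real (s j) * c))\<^sup>2 \<le> fsq X * ((cmod b)\<^sup>2 + (cmod c)\<^sup>2)"
    and "X \<noteq> 0\<^sub>m n n \<Longrightarrow>
      (cmod (of_real (s i) * b - of_real (s j) * c))\<^sup>2 = fsq X * ((cmod b)\<^sup>2 + (cmod c)\<^sup>2) \<Longrightarrow>
      of_real (s j) * b + of_real (s i) * c = 0 \<and> (b = 0 \<and> c = 0 \<or> (s i)\<^sup>2 + (s j)\<^sup>2 = fsq X)"
proof -
  consider "(s i)\<^sup>2 + (s j)\<^sup>2 \<le> fsq X" | "i = k" "j = k" "b = c"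
    using assms entry_weight_le[of i j] unfolding balanced_def by blast
  note cases = this
  show "(cmod (of_real (s i) * b - of_real (s j) * c))\<^sup>2 \<le> fsq X * ((cmod b)\<^sup>2 + (cmod c)\<^sup>2)"
    using cases by cases (auto intro: weighted_difference_le)
  assume "X \<noteq> 0\<^sub>m n n"
    and eq: "(cmod (of_real (s i) * b - of_real (s j) * c))\<^sup>2 = fsq X * ((cmod b)\<^sup>2 + (cmod c)\<^sup>2)"
  then have pos: "fsq X > 0" using fsq_pos_iff[of X n n] by simp
  show "of_real (s j) * b + of_real (s i) * c = 0 \<and> (b = 0 \<and> c = 0 \<or> (s i)\<^sup>2 + (s j)\<^sup>2 = fsq X)"
    using cases
  proof cases
    case 1
    then show ?thesis using weighted_difference_le(2)[OF 1 eq] by blast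
  next
    case 2
    then have "fsq X * ((cmod b)\<^sup>2 + (cmod c)\<^sup>2) = 0" using eq by simp
    then show ?thesis using pos by (auto simp: sum_power2_eq_zero_iff)
  qed
qed

text \<open>The factor two of the inequality: \<open>W\<close> has the same norm in both coordinate systems.\<close>

lemma two_fsq_coords:
  assumes W: "W \<in> carrier_mat n n"
  shows "2 * fsq X * fsq W = (\<Sum>i<n. \<Sum>j<n.
    fsq X * ((cmod (right_coords W $$ (i, j)))\<^sup>2 + (cmod (left_coords W $$ (i, j)))\<^sup>2))"
proof -
  have "2 * fsq X * fsq W = fsq X * (fsq (right_coords W) + fsq (left_coords W))"
    using W by (simp add: fsq_coords)
  also have "\<dots> = (\<Sum>i<n. \<Sum>j<n.
    fsq X * ((cmod (right_coords W $$ (i, j)))\<^sup>2 + (cmod (left_coords W $$ (i, j)))\<^sup>2))"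
    using W by (subst (2 3) fsq_sum) (simp add: sum_distrib_left sum.distrib distrib_left)
  finally show ?thesis .
qed

lemma balanced_comm_le:
  assumes "W \<in> carrier_mat n n" "balanced W"
  shows "fsq (comm X W) \<le> 2 * fsq X * fsq W"
  unfolding fsq_comm_coords[OF assms(1)] two_fsq_coords[OF assms(1)]
  using assms by (intro sum_mono balanced_entry_le) auto

text \<open>Equality of the norms forces equality in each entry. For nonzero \<open>X\<close> this makes the entries of
  the right and left coordinates proportional, and concentrates them where
  \<open>(s i)\<^sup>2 + (s j)\<^sup>2 = fsq X\<close>.\<close>

lemma balanced_comm_eq:
  assumes W: "W \<in> carrier_mat n n" "balanced W" and X: "X \<noteq> 0\<^sub>m n n"
    and eq: "fsq (comm X W) = 2 * fsq X * fsq W" and ij: "i < n" "j < n"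
  shows "of_real (s j) * right_coords W $$ (i, j) + of_real (s i) * left_coords W $$ (i, j) = 0"
    and "right_coords W $$ (i, j) = 0 \<and> left_coords W $$ (i, j) = 0 \<or> (s i)\<^sup>2 + (s j)\<^sup>2 = fsq X"
proof -
  let ?l = "\<lambda>i j. (cmod (of_real (s i) * right_coords W $$ (i, j) - of_real (s j) * left_coords W $$ (i, j)))\<^sup>2"
  let ?r = "\<lambda>i j. fsq X * ((cmod (right_coords W $$ (i, j)))\<^sup>2 + (cmod (left_coords W $$ (i, j)))\<^sup>2)"
  have le: "?l i j \<le> ?r i j" if "i < n" "j < n" for i j using balanced_entry_le(1)[OF W(2) that] .
  have "(\<Sum>j<n. ?l i j) = (\<Sum>j<n. ?r i j)"
    using sum_mono_inv[of "\<lambda>i. \<Sum>j<n. ?l i j" "{..<n}" "\<lambda>i. \<Sum>j<n. ?r i j" i]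
      eq[unfolded fsq_comm_coords[OF W(1)] two_fsq_coords[OF W(1)]] le ij
    by (auto intro: sum_mono)
  then have "?l i j = ?r i j"
    using sum_mono_inv[of "?l i" "{..<n}" "?r i" j] le ij by auto
  from balanced_entry_le(2)[OF W(2) ij X this]
  show "of_real (s j) * right_coords W $$ (i, j) + of_real (s i) * left_coords W $$ (i, j) = 0"
    and "right_coords W $$ (i, j) = 0 \<and> left_coords W $$ (i, j) = 0 \<or> (s i)\<^sup>2 + (s j)\<^sup>2 = fsq X"
    by blast+
qed

lemma coords_lincomb:
  assumes "A \<in> carrier_mat n n" "B \<in> carrier_mat n n"
  shows "right_coords (a \<cdot>\<^sub>m A + b \<cdot>\<^sub>m B) = a \<cdot>\<^sub>m right_coords A + b \<cdot>\<^sub>m right_coords B"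
    and "left_coords (a \<cdot>\<^sub>m A + b \<cdot>\<^sub>m B) = a \<cdot>\<^sub>m left_coords A + b \<cdot>\<^sub>m left_coords B"
  using assms by (simp_all add: right_coords_def left_coords_def sq_algebra[of _ n])

text \<open>Agreement of the two coordinates at \<open>(k, k)\<close> is one linear equation, hence solvable in
  every pencil.\<close>

lemma ex_balanced_lincomb:
  assumes A: "A \<in> carrier_mat n n" and B: "B \<in> carrier_mat n n"
  obtains a b where "a \<noteq> 0 \<or> b \<noteq> 0" "balanced (a \<cdot>\<^sub>m A + b \<cdot>\<^sub>m B)"
proof -
  define f where "f W = right_coords W $$ (k, k) - left_coords W $$ (k, k)" for W
  have f: "f (a \<cdot>\<^sub>m A + b \<cdot>\<^sub>m B) = a * f A + b * f B" for a b
    using A B k by (simp add: f_def coords_lincomb algebra_simps)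
  have "\<exists>a b. (a \<noteq> 0 \<or> b \<noteq> 0) \<and> a * f A + b * f B = 0"
  proof (cases "f A = 0")
    case True
    then show ?thesis by (intro exI[of _ 1] exI[of _ 0]) auto
  next
    case False
    then show ?thesis by (intro exI[of _ "f B"] exI[of _ "- f A"]) auto
  qed
  then obtain a b where "a \<noteq> 0 \<or> b \<noteq> 0" "f (a \<cdot>\<^sub>m A + b \<cdot>\<^sub>m B) = 0" by (auto simp: f)
  then show thesis using that[of a b] by (auto simp: f_def balanced_def)
qed

end

lemma ex_singular_values:
  assumes X: "X \<in> carrier_mat n n" and n: "n > 0"
  obtains U V s k where "singular_values n X U V s k"
proof -
  obtain U V s where UVs: "U \<in> unitary_group n" "V \<in> unitary_group n" "\<And>i. s i \<ge> 0"
    "X = U * mat_diag n (\<lambda>i. of_real (s i)) * adj V"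
    using singular_value_decomposition[OF X] by blast
  have "Max (s ` {..<n}) \<in> s ` {..<n}" using n by (intro Max_in) auto
  then obtain k where k: "k < n" "Max (s ` {..<n}) = s k" by auto
  have "s i \<le> s k" if "i < n" for i using that k(2)[symmetric] by simp
  then show thesis using UVs k that[of U V s k] by (simp add: singular_values_def)
qed

text \<open>Lu's argument: the ratio \<open>fsq [X, W] / fsq W\<close> on the pencil of \<open>Y\<close> and \<open>adj [X, Y]\<close> is at least its
  value at \<open>Y\<close>, while it is at most \<open>2 fsq X\<close> at a balanced member of the pencil.\<close>

theorem boettcher_wenzel:
  assumes XY: "X \<in> carrier_mat n n" "Y \<in> carrier_mat n n"
  shows "fsq (comm X Y) \<le> 2 * fsq X * fsq Y"
proof (cases "comm X Y = 0\<^sub>m n n")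
  case True
  then have "fsq (comm X Y) = 0" by (simp only: fsq_eq_0_iff[OF zero_carrier_mat])
  then show ?thesis by simp
next
  case False
  define Z where "Z = comm X Y"
  have Z: "Z \<in> carrier_mat n n" using XY by (simp add: Z_def)
  have "n > 0" using False XY by (cases n) auto
  then obtain U V s k where "singular_values n X U V s k" using ex_singular_values[OF XY(1)] by blast
  then interpret singular_values n X U V s k .
  obtain a b where ab: "a \<noteq> 0 \<or> b \<noteq> 0" "balanced (a \<cdot>\<^sub>m Y + b \<cdot>\<^sub>m adj Z)"
    using ex_balanced_lincomb[of Y "adj Z"] XY Z by auto
  define p q z x where pqz: "p = fsq (comm X (adj Z))" "q = fsq Y" "z = fsq Z" "x = fsq X"
  define w where "w = (cmod a)\<^sup>2 * q + (cmod b)\<^sup>2 * z"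
  have z: "z > 0" using False fsq_pos_iff[OF Z] unfolding pqz Z_def by simp
  have "Y \<noteq> 0\<^sub>m n n" using False XY(1) right_mult_zero_mat[of X n n n] left_mult_zero_mat[of X n n n] by auto
  then have q: "q > 0" using fsq_pos_iff[OF XY(2)] by (simp add: pqz)
  have w: "w > 0"
    using ab(1) z q unfolding w_def by (auto simp: add_pos_nonneg add_nonneg_pos)
  have "(cmod a)\<^sup>2 * z + (cmod b)\<^sup>2 * p \<le> 2 * x * w"
    using balanced_comm_le[OF _ ab(2)] XY Z fsq_pencil[OF XY, of a b]
    unfolding w_def pqz Z_def by simp
  then have "q * ((cmod a)\<^sup>2 * z + (cmod b)\<^sup>2 * p) \<le> q * (2 * x * w)"
    using q by (intro mult_left_mono) auto
  moreover have "(cmod b)\<^sup>2 * z\<^sup>2 \<le> (cmod b)\<^sup>2 * (p * q)"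
    using fsq_comm_adj_comm_ge[OF XY] unfolding pqz Z_def by (intro mult_left_mono) auto
  ultimately have "z * w \<le> (2 * x * q) * w"
    unfolding w_def by (simp add: algebra_simps power2_eq_square)
  then show ?thesis using w unfolding pqz Z_def by simp
qed

section \<open>Equality and common supports\<close>

text \<open>For a maximal pair the inequality at \<open>(X, adj [X, Y])\<close> leaves no room in the Cauchy--Schwarz
  inequality \<open>fsq_comm_adj_comm_ge\<close>. So \<open>[X, adj [X, Y]]\<close> is a multiple of \<open>adj Y\<close>, and
  the ratio \<open>fsq [X, W] / fsq W\<close> is constantly \<open>2 fsq X\<close> on the pencil.\<close>

lemma maximal_pencil:
  assumes XY: "X \<in> carrier_mat n n" "Y \<in> carrier_mat n n" and Y0: "Y \<noteq> 0\<^sub>m n n"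
    and max: "fsq (comm X Y) = 2 * fsq X * fsq Y"
  shows "comm X (adj (comm X Y)) = of_real (- 2 * fsq X) \<cdot>\<^sub>m adj Y"
    and "fsq (comm X (a \<cdot>\<^sub>m Y + b \<cdot>\<^sub>m adj (comm X Y))) =
      2 * fsq X * fsq (a \<cdot>\<^sub>m Y + b \<cdot>\<^sub>m adj (comm X Y))"
proof -
  define Z where "Z = comm X Y"
  have Z: "Z \<in> carrier_mat n n" using XY by (simp add: Z_def)
  define p q z x where pqz: "p = fsq (comm X (adj Z))" "q = fsq Y" "z = fsq Z" "x = fsq X"
  have zq: "z = 2 * x * q" using max by (simp add: pqz Z_def)
  have q: "q > 0" using fsq_pos_iff[OF XY(2)] Y0 by (simp add: pqz)
  have "p \<le> 2 * x * z" using boettcher_wenzel[of X n "adj Z"] XY Z by (simp add: pqz)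
  moreover have "2 * x * z \<le> p"
  proof -
    have "(2 * x * z) * q \<le> p * q"
      using fsq_comm_adj_comm_ge[OF XY] unfolding pqz[symmetric] Z_def[symmetric]
      by (simp add: zq power2_eq_square algebra_simps)
    then show ?thesis using q by simp
  qed
  ultimately have p: "p = 2 * x * z" by simp
  have "fsq (of_real 1 \<cdot>\<^sub>m comm X (adj Z) + of_real (2 * x) \<cdot>\<^sub>m adj Y) = 0"
    using fsq_comm_adj_comm_plus[OF XY, of 1 "2 * x"]
    unfolding pqz[symmetric] Z_def[symmetric] by (simp add: p zq power2_eq_square)
  then have eq: "of_real 1 \<cdot>\<^sub>m comm X (adj Z) + of_real (2 * x) \<cdot>\<^sub>m adj Y = 0\<^sub>m n n"
    using XY Z fsq_eq_0_iff[of "of_real 1 \<cdot>\<^sub>m comm X (adj Z) + of_real (2 * x) \<cdot>\<^sub>m adj Y" n n] by simp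
  show "comm X (adj (comm X Y)) = of_real (- 2 * fsq X) \<cdot>\<^sub>m adj Y"
    unfolding Z_def[symmetric] pqz[symmetric]
  proof (rule eq_matI)
    fix i j assume "i < dim_row (of_real (- 2 * x) \<cdot>\<^sub>m adj Y)" "j < dim_col (of_real (- 2 * x) \<cdot>\<^sub>m adj Y)"
    then show "comm X (adj Z) $$ (i, j) = (of_real (- 2 * x) \<cdot>\<^sub>m adj Y) $$ (i, j)"
      using arg_cong[OF eq, of "\<lambda>A. A $$ (i, j)"] XY Z
      by (simp add: add_eq_0_iff2 del: index_mult_mat(1))
  qed (use XY Z in auto)
  show "fsq (comm X (a \<cdot>\<^sub>m Y + b \<cdot>\<^sub>m adj (comm X Y))) =
      2 * fsq X * fsq (a \<cdot>\<^sub>m Y + b \<cdot>\<^sub>m adj (comm X Y))"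
    using p zq unfolding fsq_pencil[OF XY] pqz Z_def by (simp add: algebra_simps)
qed

definition is_projection :: "nat \<Rightarrow> complex mat \<Rightarrow> bool" where
  "is_projection n E \<longleftrightarrow> E \<in> carrier_mat n n \<and> adj E = E \<and> E * E = E"

definition supported :: "complex mat \<Rightarrow> complex mat \<Rightarrow> bool" where
  "supported E A \<longleftrightarrow> E * A = A \<and> A * E = A"

context
  fixes n :: nat and E :: "complex mat"
  assumes E: "is_projection n E"
begin

lemma projection_carrier: "E \<in> carrier_mat n n" and projection_adj: "adj E = E"
  using E by (auto simp: is_projection_def)

lemma supported_lincomb:
  assumes "A \<in> carrier_mat n n" "B \<in> carrier_mat n n" "supported E A" "supported E B"
  shows "supported E (a \<cdot>\<^sub>m A + b \<cdot>\<^sub>m B)"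
  using assms projection_carrier by (simp add: supported_def sq_algebra[of _ n])

lemma supported_smult:
  assumes "A \<in> carrier_mat n n" "supported E A"
  shows "supported E (a \<cdot>\<^sub>m A)"
  using assms projection_carrier by (simp add: supported_def sq_algebra[of _ n])

lemma supported_adj:
  assumes "A \<in> carrier_mat n n" "supported E A"
  shows "supported E (adj A)"
proof -
  have "adj (A * E) = E * adj A" "adj (E * A) = adj A * E"
    using assms projection_carrier by (simp_all add: sq_algebra[of _ n] projection_adj)
  then show ?thesis using assms(2) by (simp add: supported_def)
qed

lemma supported_comm:
  assumes "A \<in> carrier_mat n n" "B \<in> carrier_mat n n" "supported E A" "supported E B"
  shows "supported E (comm A B)"
proof -
  have "E * (A * B) = A * B" "A * B * E = A * B"
    if "A \<in> carrier_mat n n" "B \<in> carrier_mat n n" "supported E A" "supported E B" for A B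
    using that projection_carrier sq_algebra(1)[of E n A B] by (simp_all add: supported_def sq_algebra(1)[of A n B E])
  then show ?thesis using assms projection_carrier by (simp add: supported_def sq_algebra(4,5)[of _ n])
qed

text \<open>For \<open>W = a Y + b adj [X, Y]\<close>, the relation of \<open>maximal_pencil\<close> writes \<open>adj [X, W]\<close> as a combination
  of \<open>Y\<close> and \<open>adj [X, Y]\<close> too, and \<open>Y\<close> can be solved for:
  \<open>cnj a W - b adj [X, W] = (\<bar>a\<bar>\<^sup>2 + 2 fsq X \<bar>b\<bar>\<^sup>2) Y\<close>.\<close>

lemma supported_from_pencil:
  assumes XY: "X \<in> carrier_mat n n" "Y \<in> carrier_mat n n" and Y0: "Y \<noteq> 0\<^sub>m n n"
    and X0: "X \<noteq> 0\<^sub>m n n"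
    and max: "fsq (comm X Y) = 2 * fsq X * fsq Y"
    and ab: "a \<noteq> 0 \<or> b \<noteq> 0"
    and W: "supported E (a \<cdot>\<^sub>m Y + b \<cdot>\<^sub>m adj (comm X Y))" and EX: "supported E X"
  shows "supported E Y"
proof -
  define Z where "Z = comm X Y"
  have Z: "Z \<in> carrier_mat n n" using XY by (simp add: Z_def)
  define W where "W = a \<cdot>\<^sub>m Y + b \<cdot>\<^sub>m adj Z"
  have W': "W \<in> carrier_mat n n" "supported E W" using XY Z W by (simp_all add: W_def Z_def)
  define x where "x = fsq X"
  have x: "x > 0" using fsq_pos_iff[OF XY(1)] X0 by (simp add: x_def)
  define r where "r = (cmod a)\<^sup>2 + 2 * x * (cmod b)\<^sup>2"
  have r: "r > 0" using ab x unfolding r_def by (auto simp: add_pos_nonneg add_nonneg_pos)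
  have r': "complex_of_real r = cnj a * a + 2 * of_real x * (cnj b * b)"
    by (simp add: r_def complex_norm_square mult.commute del: of_real_power)
  have c: "comm X W = a \<cdot>\<^sub>m Z + of_real (- 2 * x) \<cdot>\<^sub>m (b \<cdot>\<^sub>m adj Y)"
    using XY Z maximal_pencil(1)[OF XY Y0 max] comm_lincomb[of X n Y "adj Z" a b]
    by (simp add: W_def Z_def[symmetric] x_def[symmetric] smult_smult_mat mult.commute)
  have "cnj a \<cdot>\<^sub>m W + (- b) \<cdot>\<^sub>m adj (comm X W) = of_real r \<cdot>\<^sub>m Y"
    unfolding c r' using XY Z by (intro eq_matI) (auto simp: W_def algebra_simps)
  moreover have "supported E (cnj a \<cdot>\<^sub>m W + (- b) \<cdot>\<^sub>m adj (comm X W))"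
    using XY W' EX by (intro supported_lincomb supported_adj supported_comm) auto
  ultimately have "supported E (of_real r \<cdot>\<^sub>m Y)" by simp
  then have "supported E (of_real (1 / r) \<cdot>\<^sub>m (of_real r \<cdot>\<^sub>m Y))"
    using XY by (intro supported_smult[of "of_real r \<cdot>\<^sub>m Y"]) auto
  then show ?thesis using r by (simp add: smult_smult_mat)
qed

text \<open>With the roles of \<open>X\<close> and \<open>Y\<close> exchanged, \<open>maximal_pencil\<close> expresses \<open>X\<close> by \<open>Y\<close> and
  \<open>[X, Y]\<close>.\<close>

lemma supported_left_of_right:
  assumes XY: "X \<in> carrier_mat n n" "Y \<in> carrier_mat n n" and X0: "X \<noteq> 0\<^sub>m n n"
    and Y0: "Y \<noteq> 0\<^sub>m n n"
    and max: "fsq (comm X Y) = 2 * fsq X * fsq Y"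
    and EY: "supported E Y" and EZ: "supported E (adj (comm X Y))"
  shows "supported E X"
proof -
  define y where "y = fsq Y"
  have y: "y > 0" using fsq_pos_iff[OF XY(2)] Y0 by (simp add: y_def)
  have neg: "comm Y X = (- 1) \<cdot>\<^sub>m comm X Y" using XY by (intro eq_matI) (auto simp del: index_mult_mat(1))
  have "fsq (comm Y X) = 2 * fsq Y * fsq X" using max unfolding neg by simp
  from maximal_pencil(1)[OF XY(2,1) X0 this]
  have "comm Y (adj (comm Y X)) = of_real (- 2 * y) \<cdot>\<^sub>m adj X" by (simp add: y_def)
  moreover have "supported E (comm Y (adj (comm Y X)))"
    unfolding neg using XY EY EZ by (intro supported_comm) (auto intro!: supported_smult)
  ultimately have "supported E (of_real (- 2 * y) \<cdot>\<^sub>m adj X)" by simp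
  then have "supported E (of_real (1 / (- 2 * y)) \<cdot>\<^sub>m adj (of_real (- 2 * y) \<cdot>\<^sub>m adj X))"
    using XY by (intro supported_smult[of "adj (of_real (- 2 * y) \<cdot>\<^sub>m adj X)"] supported_adj) auto
  then show ?thesis using y by (simp add: smult_smult_mat)
qed

end

lemma mat_diag_cong: "(\<And>i. i < n \<Longrightarrow> f i = g i) \<Longrightarrow> mat_diag n f = mat_diag n g"
  by (rule eq_matI) (auto simp: mat_diag_def)

lemma smult_mat_diag: "c \<cdot>\<^sub>m mat_diag n f = mat_diag n (\<lambda>i. c * f i)" for c :: complex
  by (rule eq_matI) (auto simp: mat_diag_def)

text \<open>The orthogonal projection onto the span of the columns of \<open>V\<close> with index in \<open>K\<close>.\<close>

definition coord_projection :: "nat \<Rightarrow> complex mat \<Rightarrow> nat set \<Rightarrow> complex mat" where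
  "coord_projection n V K = V * (mat_diag n (\<lambda>i. of_bool (i \<in> K)) * adj V)"

lemma coord_projection:
  assumes V: "V \<in> unitary_group n"
  shows "is_projection n (coord_projection n V K)"
proof -
  have [simp]: "adj (mat_diag n (\<lambda>i. of_bool (i \<in> K)) :: complex mat) = mat_diag n (\<lambda>i. of_bool (i \<in> K))"
    by (rule eq_matI) (auto simp: mat_diag_def)
  have D: "mat_diag n (\<lambda>i. of_bool (i \<in> K)) * (mat_diag n (\<lambda>i. of_bool (i \<in> K)) * A) =
     mat_diag n (\<lambda>i. of_bool (i \<in> K)) * A" if "A \<in> carrier_mat n n" for A :: "complex mat"
    using that by (simp flip: sq_algebra(1)[of _ n]) (simp flip: of_bool_conj)
  show ?thesis
    using unitary_groupD[OF V]
    by (simp add: is_projection_def coord_projection_def sq_algebra[of _ n] unitary_cancel[OF V] D)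
qed

lemma supported_coord_projection:
  assumes V: "V \<in> unitary_group n" and A: "A \<in> carrier_mat n n"
    and supp: "\<And>i j. i < n \<Longrightarrow> j < n \<Longrightarrow> (adj V * (A * V)) $$ (i, j) \<noteq> 0 \<Longrightarrow> i \<in> K \<and> j \<in> K"
  shows "supported (coord_projection n V K) A"
proof -
  note V' = unitary_groupD[OF V]
  let ?D = "mat_diag n (\<lambda>i. of_bool (i \<in> K)) :: complex mat"
  define B where "B = adj V * (A * V)"
  have B: "B \<in> carrier_mat n n" using A V' by (simp add: B_def)
  have "V * (B * adj V) = V * (adj V * (A * (V * adj V)))"
    using A V' by (simp add: B_def sq_algebra(1)[of _ n])
  also have "\<dots> = A" using A by (simp add: V'(2) unitary_cancel[OF V])
  finally have AB: "A = V * (B * adj V)" by simp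
  have "B $$ (i, j) = 0" if "i < n" "j < n" "i \<notin> K \<or> j \<notin> K" for i j
    using supp[OF that(1,2)] that(3) unfolding B_def[symmetric] by blast
  then have "?D * B = B" "B * ?D = B"
    using B by (auto simp: mat_diag_mult_left[of _ n n] mat_diag_mult_right[of _ n n] intro!: eq_matI)
  moreover have "coord_projection n V K * A = V * ((?D * B) * adj V)" 
      "A * coord_projection n V K = V * ((B * ?D) * adj V)"
    using B V' by (simp_all add: AB coord_projection_def sq_algebra(1)[of _ n] unitary_cancel[OF V])
  ultimately show ?thesis by (simp add: supported_def AB)
qed

text \<open>A singular value decomposition \<open>E = U S adj V\<close> of a projection already diagonalises it, because
  \<open>E = adj E E = V S\<^sup>2 adj V\<close>; idempotence leaves only the values \<open>0\<close> and \<open>1\<close>.\<close>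

lemma projection_is_coord_projection:
  assumes E: "is_projection n E"
  obtains V K where "V \<in> unitary_group n" "K \<subseteq> {..<n}" "of_nat (card K) = mat_trace E"
    "E = coord_projection n V K"
proof -
  have E': "E \<in> carrier_mat n n" "adj E = E" "E * E = E" using E by (auto simp: is_projection_def)
  obtain U V s where UV: "U \<in> unitary_group n" "V \<in> unitary_group n" and s: "\<And>i. s i \<ge> 0"
    and E_svd: "E = U * mat_diag n (\<lambda>i. of_real (s i)) * adj V"
    using singular_value_decomposition[OF E'(1)] by blast
  note U = unitary_groupD[OF UV(1)] and V = unitary_groupD[OF UV(2)]
  let ?S = "mat_diag n (\<lambda>i. of_real (s i)) :: complex mat"
  let ?S2 = "mat_diag n (\<lambda>i. of_real ((s i)\<^sup>2)) :: complex mat"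
  have adjS: "adj ?S = ?S" by (rule eq_matI) (auto simp: mat_diag_def)
  have S2: "?S * (?S * A) = ?S2 * A" if "A \<in> carrier_mat n n" for A
    using that by (simp add: power2_eq_square flip: sq_algebra(1)[of _ n])
  have "E = adj E * E" using E' by simp
  also have "\<dots> = V * (?S2 * adj V)"
    using U V by (simp add: E_svd sq_algebra[of _ n] adjS unitary_cancel[OF UV(1)] S2)
  finally have E2: "E = V * (?S2 * adj V)" .
  have VEV: "adj V * (E * V) = ?S2"
    using V by (simp add: E2 sq_algebra(1)[of _ n] unitary_cancel[OF UV(2)] right_mult_one_mat[of ?S2 n n]
        del: of_real_power)
  have "mat_diag n (\<lambda>i. of_real ((s i)\<^sup>2) * of_real ((s i)\<^sup>2)) = ?S2 * ?S2"
    by (simp only: mat_diag_diag)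
  also have "\<dots> = (adj V * (E * V)) * (adj V * (E * V))" unfolding VEV ..
  also have "\<dots> = adj V * (E * (V * (adj V * (E * V))))"
    using V(1) E'(1) by (simp add: sq_algebra(1)[of _ n])
  also have "\<dots> = adj V * ((E * E) * V)"
    using V E'(1) by (simp add: unitary_cancel[OF UV(2)] sq_algebra(1)[of _ n])
  also have "\<dots> = ?S2" unfolding E'(3) VEV ..
  finally have idem: "mat_diag n (\<lambda>i. of_real ((s i)\<^sup>2) * of_real ((s i)\<^sup>2)) = ?S2" .
  have "(s i)\<^sup>2 = 0 \<or> (s i)\<^sup>2 = 1" if "i < n" for i
  proof -
    have "complex_of_real ((s i)\<^sup>2 * (s i)\<^sup>2) = of_real ((s i)\<^sup>2)"
      using that arg_cong[OF idem, of "\<lambda>A. A $$ (i, i)"] by (simp add: mat_diag_def)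
    then have "(s i)\<^sup>2 * (s i)\<^sup>2 = (s i)\<^sup>2" unfolding of_real_eq_iff .
    then show ?thesis unfolding mult_cancel_right2 by blast
  qed
  then have sb: "(s i)\<^sup>2 = of_bool (s i \<noteq> 0)" if "i < n" for i using that by fastforce
  define K where "K = {i. i < n \<and> s i \<noteq> 0}"
  have S2K: "?S2 = mat_diag n (\<lambda>i. of_bool (i \<in> K))"
    by (rule eq_matI) (auto simp: mat_diag_def K_def sb simp del: of_real_power)
  have "mat_trace E = mat_trace ((?S2 * adj V) * V)"
    unfolding E2 using V by (intro trace_comm) auto
  also have "\<dots> = mat_trace ?S2"
    using V by (simp add: sq_algebra(1)[of _ n] right_mult_one_mat[of ?S2 n n] del: of_real_power)
  also have "\<dots> = of_nat (card K)"
    unfolding S2K mat_trace_def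
    by (simp add: mat_diag_def K_def of_bool_def sum.If_cases Int_def)
  finally show thesis
    using that[of V K] UV E2 unfolding S2K coord_projection_def by (auto simp: K_def)
qed

section \<open>The support of a maximal pair\<close>

text \<open>The hypotheses describe the pair of matrix units \<open>X = e\<^sub>1 adj e\<^sub>2\<close> and \<open>W = e\<^sub>2 adj e\<^sub>1\<close>, up to scalars, for an
  orthonormal pair \<open>e\<^sub>1, e\<^sub>2\<close>. The projection onto their span is \<open>(X adj X + adj X X) / fsq X\<close>, which
  does not require the vectors themselves.\<close>

lemma nilpotent_pair_support:
  assumes XW: "X \<in> carrier_mat n n" "W \<in> carrier_mat n n" and X0: "X \<noteq> 0\<^sub>m n n"
    and nil: "X * X = 0\<^sub>m n n" and iso: "X * (adj X * X) = of_real (fsq X) \<cdot>\<^sub>m X"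
    and W: "adj X * (X * W) = of_real (fsq X) \<cdot>\<^sub>m W" "X * (adj X * W) = 0\<^sub>m n n"
      "W * (X * adj X) = of_real (fsq X) \<cdot>\<^sub>m W" "W * (adj X * X) = 0\<^sub>m n n"
  obtains E where "is_projection n E" "mat_trace E = 2" "supported E X" "supported E W"
proof -
  define x where "x = complex_of_real (fsq X)"
  have x: "x \<noteq> 0" using fsq_pos_iff[OF XW(1)] X0 by (simp add: x_def)
  note iso = iso[folded x_def] and W = W[folded x_def]
  have zero: "0\<^sub>m n n * A = 0\<^sub>m n n" "A * 0\<^sub>m n n = 0\<^sub>m n n" "0\<^sub>m n n + A = A" "A + 0\<^sub>m n n = A"
    if "A \<in> carrier_mat n n" for A :: "complex mat" using that by auto
  define E where "E = (1 / x) \<cdot>\<^sub>m (X * adj X + adj X * X)"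
  have E: "E \<in> carrier_mat n n" using XW by (simp add: E_def)
  have nil2: "X * (X * A) = 0\<^sub>m n n" if A: "A \<in> carrier_mat n n" for A
    using sq_algebra(1)[OF XW(1) XW(1) A] zero(1)[OF A] by (simp only: nil)
  have nil3: "adj X * (X * X) = 0\<^sub>m n n" using XW zero by (simp add: nil)
  have EX: "E * X = X"
    using XW x nil2 nil nil3 by (simp add: E_def sq_algebra[of _ n] iso zero smult_smult_mat)
  have XE: "X * E = X"
    using XW x nil2 nil nil3 by (simp add: E_def sq_algebra[of _ n] iso zero smult_smult_mat)
  have adjE: "adj E = E"
    using XW by (simp add: E_def sq_algebra[of _ n] x_def)
  have EX': "E * adj X = adj X"
    using arg_cong[OF XE, of adj] XW E by (simp add: sq_algebra[of _ n] adjE)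
  have "E * (X * adj X + adj X * X) = X * adj X + adj X * X"
  proof -
    have "E * (X * adj X) = X * adj X" using E XW EX sq_algebra(1)[of E n X "adj X"] by simp
    moreover have "E * (adj X * X) = adj X * X" using E XW EX' sq_algebra(1)[of E n "adj X" X] by simp
    ultimately show ?thesis using E XW by (simp add: sq_algebra(2)[of _ n])
  qed
  then have EE: "E * E = E"
    using E XW by (subst (2) E_def) (simp add: sq_algebra(7)[of _ n], simp add: E_def)
  have "mat_trace (adj X * X) = mat_trace (X * adj X)" using XW by (intro trace_comm) auto
  then have tr: "mat_trace E = 2"
    using XW x by (simp add: E_def sq_trace[of _ n] trace_smult[of _ n] trace_mult_adj x_def del: of_real_power)
  have "E * W = W" "W * E = W"
    using XW W x by (simp_all add: E_def sq_algebra[of _ n] zero smult_smult_mat)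
  then show thesis
    using that[of E] E adjE EE tr EX XE by (simp add: is_projection_def supported_def)
qed

context singular_values
begin

lemma three_singular_values_le:
  "i < n \<Longrightarrow> j < n \<Longrightarrow> m < n \<Longrightarrow> distinct [i, j, m] \<Longrightarrow> (s i)\<^sup>2 + (s j)\<^sup>2 + (s m)\<^sup>2 \<le> fsq X"
  unfolding fsq_X using sum_mono2[of "{..<n}" "{i, j, m}" "\<lambda>i. (s i)\<^sup>2"] by (simp add: add.assoc)

lemma coords_recover:
  assumes "W \<in> carrier_mat n n"
  shows "V * (right_coords W * adj V) = W" "U * (left_coords W * adj U) = W"
  using assms unitary_groupD(2)[OF U] unitary_groupD(2)[OF V]
  by (simp_all add: right_coords_def left_coords_def sq_algebra(1)[of _ n]
      unitary_cancel[OF U] unitary_cancel[OF V])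

lemma right_coords_zero_iff:
  assumes "W \<in> carrier_mat n n"
  shows "right_coords W = 0\<^sub>m n n \<longleftrightarrow> W = 0\<^sub>m n n"
  using assms fsq_coords(1)[OF assms] fsq_eq_0_iff[of W n n] fsq_eq_0_iff[of "right_coords W" n n]
  by simp

lemma right_coords_nonzero_entry:
  assumes "W \<in> carrier_mat n n" "W \<noteq> 0\<^sub>m n n"
  obtains i j where "i < n" "j < n" "right_coords W $$ (i, j) \<noteq> 0"
proof -
  have "right_coords W = 0\<^sub>m n n" if "\<And>i j. i < n \<Longrightarrow> j < n \<Longrightarrow> right_coords W $$ (i, j) = 0"
    using that by (intro eq_matI) auto
  then show thesis using that right_coords_zero_iff[OF assms(1)] assms(2) by blast
qed

lemma adj_S: "adj S = S"
  by (rule eq_matI) (auto simp: mat_diag_def)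

text \<open>If no single \<open>(s i)\<^sup>2\<close> exceeds half of \<open>fsq X\<close>, then every matrix is balanced, and
  two of these squares add up to \<open>fsq X\<close> only if both are exactly half of it. As all of them sum up to
  \<open>fsq X\<close>, this happens for at most two indices (\<open>card_half_weight\<close>).\<close>

lemma small_top_support:
  assumes W: "W \<in> carrier_mat n n" and X0: "X \<noteq> 0\<^sub>m n n" and small: "2 * (s k)\<^sup>2 \<le> fsq X"
    and eq: "fsq (comm X W) = 2 * fsq X * fsq W"
  shows "supported (coord_projection n V {i. i < n \<and> 2 * (s i)\<^sup>2 = fsq X}) W"
proof (rule supported_coord_projection[OF V W])
  fix i j assume ij: "i < n" "j < n" and "(adj V * (W * V)) $$ (i, j) \<noteq> 0"
  then have "(s i)\<^sup>2 + (s j)\<^sup>2 = fsq X"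
    using balanced_comm_eq(2)[OF W _ X0 eq ij] small by (auto simp: balanced_def right_coords_def)
  moreover have "(s i)\<^sup>2 \<le> (s k)\<^sup>2" "(s j)\<^sup>2 \<le> (s k)\<^sup>2"
    using s_le ij s_nonneg by (auto intro!: power_mono)
  ultimately show "i \<in> {i. i < n \<and> 2 * (s i)\<^sup>2 = fsq X} \<and> j \<in> {i. i < n \<and> 2 * (s i)\<^sup>2 = fsq X}"
    using small ij by auto
qed

lemma card_half_weight:
  assumes X0: "X \<noteq> 0\<^sub>m n n"
  shows "card {i. i < n \<and> 2 * (s i)\<^sup>2 = fsq X} \<le> 2"
proof -
  let ?K = "{i. i < n \<and> 2 * (s i)\<^sup>2 = fsq X}"
  have pos: "fsq X > 0" using fsq_pos_iff[of X n n] X0 by simp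
  have "real (card ?K) * fsq X = 2 * (\<Sum>i\<in>?K. (s i)\<^sup>2)"
    by (simp add: sum_distrib_left)
  also have "(\<Sum>i\<in>?K. (s i)\<^sup>2) \<le> fsq X" unfolding fsq_X by (intro sum_mono2) auto
  finally show ?thesis using pos by simp
qed

context
  fixes W :: "complex mat"
  assumes W: "W \<in> carrier_mat n n" "W \<noteq> 0\<^sub>m n n" "balanced W" and X0: "X \<noteq> 0\<^sub>m n n"
    and eq: "fsq (comm X W) = 2 * fsq X * fsq W"
    and large: "2 * (s k)\<^sup>2 > fsq X"
begin

text \<open>Let \<open>(s k)\<^sup>2\<close> exceed half of \<open>fsq X\<close>. A weight \<open>(s i)\<^sup>2 + (s j)\<^sup>2 = fsq X\<close> at \<open>i = j\<close> would make
  \<open>(s i)\<^sup>2\<close> exactly half of \<open>fsq X\<close>, for which there is no room next to \<open>k\<close>; at distinct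
  \<open>i, j \<noteq> k\<close> it would leave nothing for \<open>s k\<close>.\<close>

lemma large_top_entry:
  assumes "i < n" "j < n" and nz: "right_coords W $$ (i, j) \<noteq> 0 \<or> left_coords W $$ (i, j) \<noteq> 0"
  shows "i \<noteq> j" "i = k \<or> j = k" "(s i)\<^sup>2 + (s j)\<^sup>2 = fsq X"
proof -
  show eqS: "(s i)\<^sup>2 + (s j)\<^sup>2 = fsq X"
    using balanced_comm_eq(2)[OF W(1,3) X0 eq assms(1,2)] nz by blast
  show ij: "i \<noteq> j"
  proof
    assume "i = j"
    then show False
      using eqS large two_singular_values_le[of i k] k assms by (cases "i = k") auto
  qed
  have "fsq X > 0" using fsq_pos_iff[of X n n] X0 by simp
  then have "(s k)\<^sup>2 > 0" using large by linarith
  then show "i = k \<or> j = k"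
    using eqS ij three_singular_values_le[of i j k] k assms by fastforce
qed

lemma large_top_second:
  obtains l where "l < n" "l \<noteq> k" "(s k)\<^sup>2 + (s l)\<^sup>2 = fsq X"
    "\<And>m. m < n \<Longrightarrow> m \<noteq> k \<Longrightarrow> m \<noteq> l \<Longrightarrow> s m = 0"
proof -
  obtain i j where ij: "i < n" "j < n" "right_coords W $$ (i, j) \<noteq> 0"
    using right_coords_nonzero_entry[OF W(1,2)] .
  then obtain l where l: "l < n" "l \<noteq> k" "(s k)\<^sup>2 + (s l)\<^sup>2 = fsq X"
    using large_top_entry[of i j] by (metis add.commute)
  have "s m = 0" if "m < n" "m \<noteq> k" "m \<noteq> l" for m
    using three_singular_values_le[of k l m] l k that by (auto simp: order_antisym_conv)
  with l that show thesis by blast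
qed

text \<open>Both coordinate matrices of \<open>W\<close> are antidiagonal on \<open>{k, l}\<close>, so their squares are scalar on \<open>{k, l}\<close>,
  and the scalar \<open>d\<close> is the same for both. It is nonzero, because otherwise \<open>W\<close> would have a single
  coordinate entry, whose modulus differs between the two systems by the factor \<open>s l / s k \<noteq> 1\<close>.
  Hence \<open>W\<^sup>2 / d\<close> is the projection onto the span of the two right singular vectors and also the one onto the
  span of the two left singular vectors. These spans agree, so \<open>X\<close> lives there too.\<close>

lemma rank_two_support:
  assumes l: "l < n" "l \<noteq> k" "(s k)\<^sup>2 + (s l)\<^sup>2 = fsq X"
    and rest: "\<And>m. m < n \<Longrightarrow> m \<noteq> k \<Longrightarrow> m \<noteq> l \<Longrightarrow> s m = 0" and sl: "s l \<noteq> 0"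
  shows "supported (coord_projection n V {k, l}) X" "supported (coord_projection n V {k, l}) W"
proof -
  define b where "b = right_coords W"
  define c where "c = left_coords W"
  have bc [simp]: "b \<in> carrier_mat n n" "c \<in> carrier_mat n n" using W by (simp_all add: b_def c_def)
  let ?D = "mat_diag n (\<lambda>i. of_bool (i \<in> {k, l})) :: complex mat"
  have entry: "(i, j) = (k, l) \<or> (i, j) = (l, k)"
    if "i < n" "j < n" "b $$ (i, j) \<noteq> 0 \<or> c $$ (i, j) \<noteq> 0" for i j
  proof -
    note e = large_top_entry[OF that(1,2) that(3)[unfolded b_def c_def]]
    define m where "m = (if i = k then j else i)"
    have m: "m < n" "m \<noteq> k" "(s k)\<^sup>2 + (s m)\<^sup>2 = fsq X" using e that by (auto simp: m_def)
    have "m = l"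
    proof (rule ccontr)
      assume "m \<noteq> l"
      then have "s m = 0" using rest m by blast
      then show False using m(3) l(3) sl by simp
    qed
    then show ?thesis using e by (auto simp: m_def split: if_splits)
  qed
  show "supported (coord_projection n V {k, l}) W"
    using entry unfolding b_def c_def right_coords_def
    by (intro supported_coord_projection[OF V W(1)]) blast
  have diag0: "b $$ (k, k) = 0" "b $$ (l, l) = 0" "c $$ (k, k) = 0" "c $$ (l, l) = 0"
    using entry[of k k] entry[of l l] k l by auto
  define d where "d = b $$ (k, l) * b $$ (l, k)"
  have sk: "s k > 0" "s l > 0" using sl s_nonneg[of l] s_le[OF l(1)] by auto
  have less: "(s l)\<^sup>2 < (s k)\<^sup>2" using large l(3) by linarith
  have r1: "of_real (s l) * b $$ (k, l) + of_real (s k) * c $$ (k, l) = 0"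
    and r2: "of_real (s k) * b $$ (l, k) + of_real (s l) * c $$ (l, k) = 0"
    using balanced_comm_eq(1)[OF W(1,3) X0 eq] k l unfolding b_def c_def by auto
  have c1: "c $$ (k, l) = - (of_real (s l / s k) * b $$ (k, l))"
    using r1 sk by (simp add: field_simps add_eq_0_iff)
  have c2: "c $$ (l, k) = - (of_real (s k / s l) * b $$ (l, k))"
    using r2 sk by (simp add: field_simps add_eq_0_iff)
  have dc: "d = c $$ (k, l) * c $$ (l, k)" using sk by (simp add: c1 c2 d_def)
  have square: "A * A = (A $$ (k, l) * A $$ (l, k)) \<cdot>\<^sub>m ?D"
    if A: "A \<in> carrier_mat n n" and supp: "\<And>i j. i < n \<Longrightarrow> j < n \<Longrightarrow> A $$ (i, j) \<noteq> 0 \<Longrightarrow> (i, j) = (k, l) \<or> (i, j) = (l, k)"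
    for A :: "complex mat"
  proof (rule eq_matI)
    fix i j assume "i < dim_row ((A $$ (k, l) * A $$ (l, k)) \<cdot>\<^sub>m ?D)" "j < dim_col ((A $$ (k, l) * A $$ (l, k)) \<cdot>\<^sub>m ?D)"
    then have ij: "i < n" "j < n" by (auto simp: mat_diag_def)
    have z: "A $$ (p, q) = 0" if "p < n" "q < n" "(p, q) \<noteq> (k, l)" "(p, q) \<noteq> (l, k)" for p q
      using supp[OF that(1,2)] that(3,4) by blast
    have "(A * A) $$ (i, j) = (\<Sum>m<n. A $$ (i, m) * A $$ (m, j))"
      using ij A by (simp add: mult_entry_sum[of _ n n _ n] del: index_mult_mat(1))
    also have "\<dots> = (\<Sum>m\<in>{k, l}. A $$ (i, m) * A $$ (m, j))"
      using z ij k l by (intro sum.mono_neutral_right) auto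
    also have "\<dots> = ((A $$ (k, l) * A $$ (l, k)) \<cdot>\<^sub>m ?D) $$ (i, j)"
      using z ij k l by (auto simp: mat_diag_def)
    finally show "(A * A) $$ (i, j) = ((A $$ (k, l) * A $$ (l, k)) \<cdot>\<^sub>m ?D) $$ (i, j)" .
  qed (use A in \<open>auto simp: mat_diag_def\<close>)
  have bb: "b * b = d \<cdot>\<^sub>m ?D" using square[of b] entry by (auto simp: d_def)
  have cc: "c * c = d \<cdot>\<^sub>m ?D" using square[of c] entry by (auto simp: dc)
  have d0: "d \<noteq> 0"
  proof
    assume "d = 0"
    have two: "fsq A = (cmod (A $$ (k, l)))\<^sup>2 + (cmod (A $$ (l, k)))\<^sup>2"
      if A: "A \<in> carrier_mat n n" and supp: "\<And>i j. i < n \<Longrightarrow> j < n \<Longrightarrow> A $$ (i, j) \<noteq> 0 \<Longrightarrow> (i, j) = (k, l) \<or> (i, j) = (l, k)"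
      for A :: "complex mat"
    proof -
      have z: "A $$ (i, j) = 0" if "i < n" "j < n" "(i, j) \<noteq> (k, l)" "(i, j) \<noteq> (l, k)" for i j
        using supp[OF that(1,2)] that(3,4) by blast
      have "fsq A = (\<Sum>(i, j)\<in>{..<n} \<times> {..<n}. (cmod (A $$ (i, j)))\<^sup>2)"
        using A by (simp add: fsq_sum sum.cartesian_product)
      also have "\<dots> = (\<Sum>(i, j)\<in>{(k, l), (l, k)}. (cmod (A $$ (i, j)))\<^sup>2)"
        using z k l by (intro sum.mono_neutral_right) auto
      finally show ?thesis using l by simp
    qed
    have "fsq b = fsq c" using W by (simp add: b_def c_def fsq_coords)
    then have norms: "(cmod (b $$ (k, l)))\<^sup>2 + (cmod (b $$ (l, k)))\<^sup>2 =
        (s l / s k)\<^sup>2 * (cmod (b $$ (k, l)))\<^sup>2 + (s k / s l)\<^sup>2 * (cmod (b $$ (l, k)))\<^sup>2"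
      using two[of b] two[of c] entry sk
      by (simp add: c1 c2 norm_mult norm_divide power_mult_distrib power_divide)
    have ne: "(s l / s k)\<^sup>2 \<noteq> 1" "(s k / s l)\<^sup>2 \<noteq> 1" using less sk by (auto simp: power_divide)
    have "b $$ (k, l) = 0 \<or> b $$ (l, k) = 0" using \<open>d = 0\<close> by (simp add: d_def)
    then have "b $$ (k, l) = 0" "b $$ (l, k) = 0" using norms ne by auto
    then have "fsq b = 0" using two[of b] entry by simp
    then show False
      using W right_coords_zero_iff[OF W(1)] fsq_eq_0_iff[of b n n] by (simp add: b_def)
  qed
  have WW: "W * W = d \<cdot>\<^sub>m coord_projection n V {k, l}" "W * W = d \<cdot>\<^sub>m coord_projection n U {k, l}"
  proof -
    have "W * W = V * ((b * b) * adj V)"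
      using coords_recover(1)[OF W(1), symmetric] unfolding b_def[symmetric]
      by (simp add: sq_algebra(1)[of _ n] unitary_cancel[OF V])
    then show "W * W = d \<cdot>\<^sub>m coord_projection n V {k, l}"
      unfolding bb coord_projection_def by (simp add: sq_algebra(6,7)[of _ n])
    have "W * W = U * ((c * c) * adj U)"
      using coords_recover(2)[OF W(1), symmetric] unfolding c_def[symmetric]
      by (simp add: sq_algebra(1)[of _ n] unitary_cancel[OF U])
    then show "W * W = d \<cdot>\<^sub>m coord_projection n U {k, l}"
      unfolding cc coord_projection_def by (simp add: sq_algebra(6,7)[of _ n])
  qed
  have "(1 / d) \<cdot>\<^sub>m (d \<cdot>\<^sub>m coord_projection n V {k, l}) = (1 / d) \<cdot>\<^sub>m (d \<cdot>\<^sub>m coord_projection n U {k, l})"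
    using WW by simp
  then have EE: "coord_projection n V {k, l} = coord_projection n U {k, l}"
    using d0 by (simp add: smult_smult_mat)
  have DS_entry: "of_bool (i \<in> {k, l}) * complex_of_real (s i) = of_real (s i)" if "i < n" for i
    using rest[OF that] by (cases "i \<in> {k, l}") auto
  have DS: "?D * S = S" "S * ?D = S"
    unfolding mat_diag_diag
    by (rule mat_diag_cong, rule DS_entry, assumption)
      (rule mat_diag_cong, subst mult.commute, rule DS_entry)
  have "coord_projection n U {k, l} * X = U * ((?D * S) * adj V)"
    by (simp add: coord_projection_def X_svd sq_algebra(1)[of _ n] unitary_cancel[OF U]
        del: mat_diag_diag)
  moreover have "X * coord_projection n V {k, l} = U * ((S * ?D) * adj V)"
    by (simp add: coord_projection_def X_svd sq_algebra(1)[of _ n] unitary_cancel[OF V]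
        del: mat_diag_diag)
  ultimately show "supported (coord_projection n V {k, l}) X"
    unfolding supported_def DS by (simp add: EE X_svd sq_algebra(1)[of _ n])
qed

text \<open>Here \<open>X\<close> is a multiple of \<open>u adj v\<close> with its singular vectors \<open>u, v\<close>. The proportionality of the entries
  leaves for \<open>W\<close> only row \<open>k\<close> in right coordinates and only column \<open>k\<close> in left coordinates, so \<open>W\<close> is a
  multiple of \<open>v adj u\<close>. The zero at \<open>(k, k)\<close> makes \<open>u\<close> and \<open>v\<close> orthogonal.\<close>

lemma rank_one_support:
  assumes rest: "\<And>m. m < n \<Longrightarrow> m \<noteq> k \<Longrightarrow> s m = 0"
  obtains E where "is_projection n E" "mat_trace E = 2" "supported E X" "supported E W"
proof -
  define b where "b = right_coords W"
  define c where "c = left_coords W"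
  have bc [simp]: "b \<in> carrier_mat n n" "c \<in> carrier_mat n n" using W by (simp_all add: b_def c_def)
  have Sk: "fsq X = (s k)\<^sup>2"
    unfolding fsq_X using rest k by (simp add: sum.remove[of "{..<n}" k])
  have pos: "fsq X > 0" using fsq_pos_iff[of X n n] X0 by simp
  then have sk: "s k \<noteq> 0" using Sk by auto
  have b0: "b $$ (i, j) = 0" if "i < n" "j < n" "i \<noteq> k \<or> j = k" for i j
  proof (rule ccontr)
    assume "b $$ (i, j) \<noteq> 0"
    then have e: "i \<noteq> j" "i = k \<or> j = k" using large_top_entry[OF that(1,2)] by (auto simp: b_def)
    then have "j = k" "i \<noteq> k" using that by auto
    then show False
      using balanced_comm_eq(1)[OF W(1,3) X0 eq that(1,2)] \<open>b $$ (i, j) \<noteq> 0\<close> sk rest[of i] that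
      by (simp add: b_def)
  qed
  have c0: "c $$ (i, j) = 0" if "i < n" "j < n" "j \<noteq> k \<or> i = k" for i j
  proof (rule ccontr)
    assume "c $$ (i, j) \<noteq> 0"
    then have e: "i \<noteq> j" "i = k \<or> j = k" using large_top_entry[OF that(1,2)] by (auto simp: c_def)
    then have "i = k" "j \<noteq> k" using that by auto
    then show False
      using balanced_comm_eq(1)[OF W(1,3) X0 eq that(1,2)] \<open>c $$ (i, j) \<noteq> 0\<close> sk rest[of j] that
      by (simp add: c_def)
  qed
  obtain p q where pq: "p < n" "q < n" "b $$ (p, q) \<noteq> 0"
    using right_coords_nonzero_entry[OF W(1,2)] unfolding b_def by blast
  then have pk: "p = k" using b0 by blast
  \<comment> \<open>\<open>M\<close> is the change of basis; its entry at \<open>(k, k)\<close> is the inner product of the top singular vectors\<close>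
  define M where "M = adj V * U"
  have M: "M \<in> carrier_mat n n" by (simp add: M_def)
  have "adj M * b = c * adj M"
    using W(1) by (simp add: M_def b_def c_def right_coords_def left_coords_def sq_algebra[of _ n]
        unitary_cancel[OF V] unitary_cancel[OF U])
  then have "(adj M * b) $$ (k, q) = (c * adj M) $$ (k, q)" by simp
  then have "(\<Sum>i<n. cnj (M $$ (i, k)) * b $$ (i, q)) = (\<Sum>i<n. c $$ (k, i) * adj M $$ (i, q))"
    using M k pq by (simp add: mult_entry_sum[of _ n n _ n] del: index_mult_mat(1))
  also have "\<dots> = 0" using c0 k by (intro sum.neutral) auto
  also have "(\<Sum>i<n. cnj (M $$ (i, k)) * b $$ (i, q)) = cnj (M $$ (k, k)) * b $$ (k, q)"
    using b0 k pq by (subst sum.remove[of _ k]) (auto intro!: sum.neutral)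
  finally have Mkk: "M $$ (k, k) = 0" using pq pk by simp
  have SMS: "S * (M * S) = 0\<^sub>m n n"
  proof -
    have "S * (M * S) = mat n n (\<lambda>(i, j). of_real (s i) * (M $$ (i, j) * of_real (s j)))"
      using M by (intro eq_matI) (auto simp: mat_diag_mult_left[of _ n n] mat_diag_mult_right[of _ n n])
    also have "of_real (s i) * (M $$ (i, j) * of_real (s j)) = 0" if "i < n" "j < n" for i j
      using that rest Mkk by (cases "i = k"; cases "j = k") auto
    then have "mat n n (\<lambda>(i, j). of_real (s i) * (M $$ (i, j) * of_real (s j))) = 0\<^sub>m n n"
      by (intro eq_matI) auto
    finally show ?thesis .
  qed
  have nil: "X * X = 0\<^sub>m n n"
  proof -
    have "X * X = U * ((S * (M * S)) * adj V)"
      by (simp add: X_svd M_def sq_algebra(1)[of _ n])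
    then show ?thesis unfolding SMS
      using left_mult_zero_mat[of "adj V" n n n] right_mult_zero_mat[of U n n n] by simp
  qed
  let ?x = "complex_of_real (fsq X)"
  have SSS: "S * (S * S) = ?x \<cdot>\<^sub>m S"
    unfolding mat_diag_diag smult_mat_diag
  proof (rule mat_diag_cong)
    fix i assume "i < n"
    then show "complex_of_real (s i) * (of_real (s i) * of_real (s i)) = ?x * of_real (s i)"
      using rest Sk by (cases "i = k") (simp_all add: power2_eq_square)
  qed
  have iso: "X * (adj X * X) = ?x \<cdot>\<^sub>m X"
  proof -
    have "X * (adj X * X) = U * ((S * (S * S)) * adj V)"
      by (simp add: X_svd sq_algebra(1,8)[of _ n] adj_S unitary_cancel[OF U] unitary_cancel[OF V]
          del: mat_diag_diag)
    then show ?thesis unfolding SSS by (simp add: X_svd sq_algebra(1,6,7)[of _ n])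
  qed
  have SSA: "S * (S * A) = mat n n (\<lambda>(i, j). of_real ((s i)\<^sup>2) * A $$ (i, j))"
    and ASS: "A * (S * S) = mat n n (\<lambda>(i, j). of_real ((s j)\<^sup>2) * A $$ (i, j))"
    if A: "A \<in> carrier_mat n n" for A
  proof -
    have "S * (S * A) = (S * S) * A" by (rule sq_algebra(1)[symmetric]) (use A in auto)
    then show "S * (S * A) = mat n n (\<lambda>(i, j). of_real ((s i)\<^sup>2) * A $$ (i, j))"
      using A by (simp add: mat_diag_mult_left[of _ n n] power2_eq_square)
    show "A * (S * S) = mat n n (\<lambda>(i, j). of_real ((s j)\<^sup>2) * A $$ (i, j))"
      using A by (simp add: mat_diag_mult_right[of _ n n] power2_eq_square mult.commute)
  qed
  have srest: "(s i)\<^sup>2 = (if i = k then fsq X else 0)" if "i < n" for i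
    using rest[OF that] Sk by simp
  have SSb: "S * (S * b) = ?x \<cdot>\<^sub>m b" "b * (S * S) = 0\<^sub>m n n"
    unfolding SSA[OF bc(1)] ASS[OF bc(1)]
    using b0 k carrier_matD[OF bc(1)] by (auto simp: srest simp del: of_real_power intro!: eq_matI)
  have SSc: "S * (S * c) = 0\<^sub>m n n" "c * (S * S) = ?x \<cdot>\<^sub>m c"
    unfolding SSA[OF bc(2)] ASS[OF bc(2)]
    using c0 k carrier_matD[OF bc(2)] by (auto simp: srest simp del: of_real_power intro!: eq_matI)
  note Wb = coords_recover(1)[OF W(1), folded b_def] and Wc = coords_recover(2)[OF W(1), folded c_def]
  have zero: "V * (0\<^sub>m n n * adj V) = 0\<^sub>m n n" "U * (0\<^sub>m n n * adj U) = 0\<^sub>m n n"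
    using left_mult_zero_mat[of "adj V" n n n] right_mult_zero_mat[of V n n n]
      left_mult_zero_mat[of "adj U" n n n] right_mult_zero_mat[of U n n n] by simp_all
  have "adj X * (X * (V * (b * adj V))) = V * ((S * (S * b)) * adj V)"
    by (simp add: X_svd sq_algebra(1,8)[of _ n] adj_S unitary_cancel[OF U] unitary_cancel[OF V]
        del: mat_diag_diag)
  then have W1: "adj X * (X * W) = ?x \<cdot>\<^sub>m W"
    unfolding SSb Wb by (simp add: sq_algebra(6,7)[of _ n] Wb)
  have "X * (adj X * (U * (c * adj U))) = U * ((S * (S * c)) * adj U)"
    by (simp add: X_svd sq_algebra(1,8)[of _ n] adj_S unitary_cancel[OF U] unitary_cancel[OF V]
        del: mat_diag_diag)
  then have W2: "X * (adj X * W) = 0\<^sub>m n n" unfolding SSc Wc zero .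
  have "(U * (c * adj U)) * (X * adj X) = U * ((c * (S * S)) * adj U)"
    by (simp add: X_svd sq_algebra(1,8)[of _ n] adj_S unitary_cancel[OF U] unitary_cancel[OF V]
        del: mat_diag_diag)
  then have W3: "W * (X * adj X) = ?x \<cdot>\<^sub>m W"
    unfolding SSc Wc by (simp add: sq_algebra(6,7)[of _ n] Wc)
  have "(V * (b * adj V)) * (adj X * X) = V * ((b * (S * S)) * adj V)"
    by (simp add: X_svd sq_algebra(1,8)[of _ n] adj_S unitary_cancel[OF U] unitary_cancel[OF V]
        del: mat_diag_diag)
  then have W4: "W * (adj X * X) = 0\<^sub>m n n" unfolding SSb Wb zero .
  show thesis
    using nilpotent_pair_support[OF X_carrier W(1) X0 nil iso W1 W2 W3 W4] that by blast
qed

end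

end

text \<open>If \<open>(s k)\<^sup>2\<close> is at most half of \<open>fsq X\<close>, then both \<open>Y\<close> and \<open>adj [X, Y]\<close> are balanced, so they have a
  common support, and \<open>X\<close> follows from them. Otherwise \<open>X\<close> and one balanced member of the pencil have a
  common support, and \<open>Y\<close> follows from these two.\<close>

theorem maximal_common_support:
  assumes XY: "X \<in> carrier_mat n n" "Y \<in> carrier_mat n n"
    and X0: "X \<noteq> 0\<^sub>m n n" and Y0: "Y \<noteq> 0\<^sub>m n n"
    and max: "fsq (comm X Y) = 2 * fsq X * fsq Y"
  obtains V K where "V \<in> unitary_group n" "K \<subseteq> {..<n}" "card K \<le> 2"
    "supported (coord_projection n V K) X" "supported (coord_projection n V K) Y"
proof -
  have "n > 0" using X0 XY by (cases n) auto
  then obtain U V s k where "singular_values n X U V s k" using ex_singular_values[OF XY(1)] by blast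
  then interpret singular_values n X U V s k .
  define Z where "Z = comm X Y"
  have Z: "Z \<in> carrier_mat n n" using XY by (simp add: Z_def)
  show thesis
  proof (cases "2 * (s k)\<^sup>2 \<le> fsq X")
    case True
    let ?K = "{i. i < n \<and> 2 * (s i)\<^sup>2 = fsq X}"
    have "fsq (comm X (adj Z)) = 2 * fsq X * fsq (adj Z)"
      using maximal_pencil(2)[OF XY Y0 max, of 0 1] XY Z fsq_pencil[OF XY, of 0 1]
      unfolding Z_def[symmetric] by simp
    then have sZ: "supported (coord_projection n V ?K) (adj Z)"
      using small_top_support[OF _ X0 True] Z by simp
    have sY: "supported (coord_projection n V ?K) Y"
      using small_top_support[OF XY(2) X0 True max] .
    have "supported (coord_projection n V ?K) X"
      using supported_left_of_right[OF coord_projection[OF V] XY X0 Y0 max sY] sZ by (simp add: Z_def)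
    with sY show thesis using that[OF V _ card_half_weight[OF X0]] by auto
  next
    case False
    then have large: "2 * (s k)\<^sup>2 > fsq X" by simp
    obtain a b where ab: "a \<noteq> 0 \<or> b \<noteq> 0" "balanced (a \<cdot>\<^sub>m Y + b \<cdot>\<^sub>m adj Z)"
      using ex_balanced_lincomb[of Y "adj Z"] XY Z by auto
    define W where "W = a \<cdot>\<^sub>m Y + b \<cdot>\<^sub>m adj Z"
    have W: "W \<in> carrier_mat n n" "balanced W" using ab XY Z by (simp_all add: W_def)
    have eq: "fsq (comm X W) = 2 * fsq X * fsq W"
      using maximal_pencil(2)[OF XY Y0 max] by (simp add: W_def Z_def)
    have x: "fsq X > 0" "fsq Y > 0" using fsq_pos_iff XY X0 Y0 by blast+
    then have "fsq W > 0"
      using ab(1) fsq_pencil(1)[OF XY, of a b] max unfolding W_def Z_def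
      by (auto simp: add_pos_nonneg add_nonneg_pos)
    then have W0: "W \<noteq> 0\<^sub>m n n" using fsq_pos_iff[OF W(1)] by blast
    note ctxt = W(1) W0 W(2) X0 eq large
    note pencil = supported_from_pencil[OF _ XY Y0 X0 max ab(1), folded Z_def, folded W_def]
    obtain l where l: "l < n" "l \<noteq> k" "(s k)\<^sup>2 + (s l)\<^sup>2 = fsq X"
      "\<And>m. m < n \<Longrightarrow> m \<noteq> k \<Longrightarrow> m \<noteq> l \<Longrightarrow> s m = 0"
      using large_top_second[OF ctxt] by blast
    show thesis
    proof (cases "s l = 0")
      case False
      note supp = rank_two_support[OF ctxt l False]
      show thesis
      proof (rule that[OF V])
        show "{k, l} \<subseteq> {..<n}" "card {k, l} \<le> 2" using k l by auto
        show "supported (coord_projection n V {k, l}) X" by (rule supp(1))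
        show "supported (coord_projection n V {k, l}) Y"
          by (rule pencil[OF coord_projection[OF V] supp(2,1)])
      qed
    next
      case True
      with l have "s m = 0" if "m < n" "m \<noteq> k" for m using that by (cases "m = l") auto
      then obtain E where E: "is_projection n E" "mat_trace E = 2" "supported E X" "supported E W"
        using rank_one_support[OF ctxt] by blast
      obtain V' K where VK: "V' \<in> unitary_group n" "K \<subseteq> {..<n}" "of_nat (card K) = mat_trace E"
        "E = coord_projection n V' K"
        using projection_is_coord_projection[OF E(1)] by blast
      then have "of_nat (card K) = (of_nat 2 :: complex)" using E(2) by simp
      then have "card K = 2" unfolding of_nat_eq_iff .
      then show thesis using that[OF VK(1,2)] E pencil[OF E(1,4,3)] VK(4) by simp
    qed
  qed
qed

section \<open>Commutators of 2x2 matrices\<close>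


text \<open>Lagrange's identity in \<open>\<complex>\<^sup>3\<close>.\<close>

lemma lagrange_three:
  fixes x1 x2 x3 y1 y2 y3 :: complex
  shows "(cmod (x1 * y2 - x2 * y1))\<^sup>2 + (cmod (x1 * y3 - x3 * y1))\<^sup>2 + (cmod (x2 * y3 - x3 * y2))\<^sup>2
    + (cmod (x1 * cnj y1 + x2 * cnj y2 + x3 * cnj y3))\<^sup>2 =
    ((cmod x1)\<^sup>2 + (cmod x2)\<^sup>2 + (cmod x3)\<^sup>2) * ((cmod y1)\<^sup>2 + (cmod y2)\<^sup>2 + (cmod y3)\<^sup>2)"
proof -
  have "complex_of_real ((cmod (x1 * y2 - x2 * y1))\<^sup>2 + (cmod (x1 * y3 - x3 * y1))\<^sup>2
      + (cmod (x2 * y3 - x3 * y2))\<^sup>2 + (cmod (x1 * cnj y1 + x2 * cnj y2 + x3 * cnj y3))\<^sup>2) =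
    of_real (((cmod x1)\<^sup>2 + (cmod x2)\<^sup>2 + (cmod x3)\<^sup>2) * ((cmod y1)\<^sup>2 + (cmod y2)\<^sup>2 + (cmod y3)\<^sup>2))"
    unfolding of_real_add of_real_mult complex_norm_square by (simp add: algebra_simps)
  then show ?thesis unfolding of_real_eq_iff .
qed

text \<open>The traceless part of the matrix with rows \<open>(a, b)\<close> and \<open>(c, d)\<close> corresponds to the vector
  \<open>((a - d) / \<surd>2, b, c)\<close> in \<open>\<complex>\<^sup>3\<close> of the same norm. The commutator then corresponds to the cross product,
  up to a factor \<open>\<surd>2\<close> and the order and signs of the coordinates, and the claim is Lagrange's identity.\<close>

lemma commutator_2x2_defect:
  fixes a b c d e f g h :: complex
  defines "p \<equiv> (cmod (a - d))\<^sup>2 / 2 + (cmod b)\<^sup>2 + (cmod c)\<^sup>2"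
    and "q \<equiv> (cmod (e - h))\<^sup>2 / 2 + (cmod f)\<^sup>2 + (cmod g)\<^sup>2"
  shows "2 * (cmod (b * g - f * c))\<^sup>2 + (cmod ((a - d) * f - b * (e - h)))\<^sup>2
      + (cmod (c * (e - h) - g * (a - d)))\<^sup>2
    = 2 * (p * q - (cmod ((a - d) * cnj (e - h) / 2 + b * cnj f + c * cnj g))\<^sup>2)"
proof -
  let ?r = "complex_of_real (sqrt 2)"
  have r: "?r * ?r = 2" by (simp flip: of_real_mult)
  have half: "(cmod (z / ?r))\<^sup>2 = (cmod z)\<^sup>2 / 2" for z by (simp add: norm_divide power_divide)
  have pull: "x / ?r * y - z * (w / ?r) = (x * y - z * w) / ?r" for x y z w
    by (simp add: diff_divide_distrib)
  have t1: "(cmod ((a - d) / ?r * f - b * ((e - h) / ?r)))\<^sup>2 = (cmod ((a - d) * f - b * (e - h)))\<^sup>2 / 2"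
    unfolding pull half ..
  have t2: "(cmod ((a - d) / ?r * g - c * ((e - h) / ?r)))\<^sup>2 = (cmod (c * (e - h) - g * (a - d)))\<^sup>2 / 2"
    unfolding pull half norm_minus_commute[of "(a - d) * g"] by (simp add: mult.commute)
  have t3: "(a - d) / ?r * cnj ((e - h) / ?r) = (a - d) * cnj (e - h) / 2"
    by (simp add: r)
  have t4: "(cmod (b * g - c * f))\<^sup>2 = (cmod (b * g - f * c))\<^sup>2" by (simp add: mult.commute)
  have double: "2 * t + u + v = 2 * (w - z)" if "u / 2 + v / 2 + t + z = w" for t u v w z :: real
    using that by simp
  show ?thesis
    using lagrange_three[of "(a - d) / ?r" f b "(e - h) / ?r" g c]
    unfolding t1 t2 t3 t4 half p_def[symmetric] q_def[symmetric] by (rule double)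
qed

lemma two_by_two_norm_expand:
  fixes a d :: complex
  shows "(cmod a)\<^sup>2 + (cmod d)\<^sup>2 = (cmod (a - d))\<^sup>2 / 2 + (cmod (a + d))\<^sup>2 / 2"
  unfolding cmod_power2 by (simp add: power2_eq_square field_simps)

lemma sum_lessThan_2: "(\<Sum>i<2. f i) = f 0 + f (1 :: nat)" for f :: "nat \<Rightarrow> 'a :: comm_monoid_add"
  by (simp add: numeral_2_eq_2)

text \<open>With the squared norms \<open>p, q\<close> of the traceless parts, their inner product \<open>i\<close>, and the squared norms \<open>u, v\<close>
  of the scalar parts, which do not influence the commutator, maximality reads
  \<open>p q - \<bar>i\<bar>\<^sup>2 = (p + u) (q + v)\<close>. For nonzero matrices this means that \<open>i\<close>, \<open>u\<close> and \<open>v\<close> all vanish.\<close>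

lemma maximal_pair_2_iff:
  assumes X: "X \<in> carrier_mat 2 2" and Y: "Y \<in> carrier_mat 2 2"
  shows "maximal_pair 2 X Y \<longleftrightarrow> X \<noteq> 0\<^sub>m 2 2 \<and> Y \<noteq> 0\<^sub>m 2 2 \<and>
    mat_trace (X * adj Y) = 0 \<and> mat_trace X = 0 \<and> mat_trace Y = 0"
proof (cases "X = 0\<^sub>m 2 2 \<or> Y = 0\<^sub>m 2 2")
  case True
  then show ?thesis by (auto simp: maximal_pair_def)
next
  case False
  define a b c d where abcd: "a = X $$ (0, 0)" "b = X $$ (0, Suc 0)" "c = X $$ (Suc 0, 0)" "d = X $$ (Suc 0, Suc 0)"
  define e f g h where efgh: "e = Y $$ (0, 0)" "f = Y $$ (0, Suc 0)" "g = Y $$ (Suc 0, 0)" "h = Y $$ (Suc 0, Suc 0)"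
  define p q where pq: "p = (cmod (a - d))\<^sup>2 / 2 + (cmod b)\<^sup>2 + (cmod c)\<^sup>2"
    "q = (cmod (e - h))\<^sup>2 / 2 + (cmod f)\<^sup>2 + (cmod g)\<^sup>2"
  define i where "i = (a - d) * cnj (e - h) / 2 + b * cnj f + c * cnj g"
  define u v where uv: "u = (cmod (a + d))\<^sup>2 / 2" "v = (cmod (e + h))\<^sup>2 / 2"
  have nonneg: "p \<ge> 0" "q \<ge> 0" "u \<ge> 0" "v \<ge> 0" by (simp_all add: pq uv)
  have fX: "fsq X = p + u" and fY: "fsq Y = q + v"
    using X Y two_by_two_norm_expand[of a d] two_by_two_norm_expand[of e h]
    by (simp_all add: fsq_sum sum_lessThan_2 pq uv flip: abcd efgh)
  have "fsq (comm X Y) = (cmod (b * g - f * c))\<^sup>2 + (cmod ((a - d) * f - b * (e - h)))\<^sup>2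
      + (cmod (c * (e - h) - g * (a - d)))\<^sup>2 + (cmod (c * f - g * b))\<^sup>2"
    using X Y
    by (simp add: fsq_sum sum_lessThan_2 mult_entry_sum[of _ 2 2 _ 2] algebra_simps
        del: index_mult_mat(1) flip: abcd efgh)
  also have "(cmod (c * f - g * b))\<^sup>2 = (cmod (b * g - f * c))\<^sup>2"
    by (metis mult.commute norm_minus_commute)
  finally have fc: "fsq (comm X Y) = 2 * (p * q - (cmod i)\<^sup>2)"
    using commutator_2x2_defect[of b g f c a d e h] unfolding pq i_def by simp
  have tr: "mat_trace X = a + d" "mat_trace Y = e + h"
    using X Y by (simp_all add: mat_trace_def sum_lessThan_2 abcd efgh)
  have trXY: "mat_trace (X * adj Y) = i + (a + d) * cnj (e + h) / 2"
    using X Y by (simp add: trace_mult_sum[of _ 2 2] sum_lessThan_2 i_def field_simps flip: abcd efgh)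
  have pos: "p + u > 0" "q + v > 0"
    using False X Y fsq_pos_iff[of X 2 2] fsq_pos_iff[of Y 2 2] by (simp_all flip: fX fY)
  have "maximal_pair 2 X Y \<longleftrightarrow> 2 * (p * q - (cmod i)\<^sup>2) = 2 * (p + u) * (q + v)"
    using X Y False by (simp only: maximal_pair_def fc fX fY) simp
  also have "\<dots> \<longleftrightarrow> (cmod i)\<^sup>2 + p * v + u * (q + v) = 0"
    by (auto simp: algebra_simps)
  also have "\<dots> \<longleftrightarrow> i = 0 \<and> u = 0 \<and> v = 0"
  proof
    assume sum0: "(cmod i)\<^sup>2 + p * v + u * (q + v) = 0"
    moreover have "(cmod i)\<^sup>2 \<ge> 0" "p * v \<ge> 0" "u * (q + v) \<ge> 0" using nonneg by auto
    ultimately have "(cmod i)\<^sup>2 = 0" "p * v = 0" "u * (q + v) = 0" by linarith+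
    then show "i = 0 \<and> u = 0 \<and> v = 0" using pos by auto
  qed auto
  also have "\<dots> \<longleftrightarrow> mat_trace (X * adj Y) = 0 \<and> mat_trace X = 0 \<and> mat_trace Y = 0"
    by (auto simp: tr trXY uv)
  finally show ?thesis using False by simp
qed

section \<open>Unitary reduction to the corner\<close>

lemma corner_block:
  assumes A: "A \<in> carrier_mat 2 2" and n: "n \<ge> 2"
  shows "diag_block_mat [A, 0\<^sub>m (n - 2) (n - 2)] =
    mat n n (\<lambda>(i, j). if i < 2 \<and> j < 2 then A $$ (i, j) else 0)"
  using assms by (intro eq_matI) (auto simp: Let_def)

lemma sum_first_two:
  fixes f :: "nat \<Rightarrow> 'a :: comm_monoid_add"
  assumes "n \<ge> 2"
  shows "(\<Sum>i<n. if i < 2 then f i else 0) = (\<Sum>i<2. f i)"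
  using assms by (simp add: sum.If_cases Int_absorb1 subset_eq flip: lessThan_def)

lemma fsq_corner_block:
  assumes A: "A \<in> carrier_mat 2 2" and n: "n \<ge> 2"
  shows "fsq (diag_block_mat [A, 0\<^sub>m (n - 2) (n - 2)]) = fsq A"
proof -
  have "(\<Sum>j<n. (cmod (if i < 2 \<and> j < 2 then A $$ (i, j) else 0))\<^sup>2) =
      (if i < 2 then \<Sum>j<2. (cmod (A $$ (i, j)))\<^sup>2 else 0)" for i
    using sum_first_two[OF n, of "\<lambda>j. (cmod (A $$ (i, j)))\<^sup>2"]
    by (auto simp: if_distrib[of cmod] if_distrib[of "\<lambda>x. x\<^sup>2"] cong: if_cong)
  then show ?thesis
    unfolding corner_block[OF A n]
    using A sum_first_two[OF n, of "\<lambda>i. \<Sum>j<2. (cmod (A $$ (i, j)))\<^sup>2"] by (simp add: fsq_sum)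
qed

lemma comm_corner_block:
  assumes "A \<in> carrier_mat 2 2" "B \<in> carrier_mat 2 2" "n \<ge> 2"
  shows "comm (diag_block_mat [A, 0\<^sub>m (n - 2) (n - 2)]) (diag_block_mat [B, 0\<^sub>m (n - 2) (n - 2)]) =
    diag_block_mat [comm A B, 0\<^sub>m (n - 2) (n - 2)]"
proof -
  have prod: "diag_block_mat [A, 0\<^sub>m (n - 2) (n - 2)] * diag_block_mat [B, 0\<^sub>m (n - 2) (n - 2)] =
      diag_block_mat [A * B, 0\<^sub>m (n - 2) (n - 2)]"
    if A: "A \<in> carrier_mat 2 2" and B: "B \<in> carrier_mat 2 2" for A B :: "complex mat"
    using A B by (simp add: Let_def mult_four_block_mat[of _ 2 2 _ "n - 2" _ "n - 2" _ _ 2 _ "n - 2"])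
  have "A * B \<in> carrier_mat 2 2" "B * A \<in> carrier_mat 2 2" "comm A B \<in> carrier_mat 2 2"
    using assms by auto
  then show ?thesis
    unfolding prod[OF assms(1,2)] prod[OF assms(2,1)]
    using assms by (simp only: corner_block) (intro eq_matI, auto)
qed

text \<open>Neither padding with zeros nor unitary conjugation changes Frobenius norms, and both commute with
  the commutator.\<close>

lemma maximal_pair_corner:
  assumes n: "n \<ge> 2" and U: "U \<in> unitary_group n"
    and A: "A \<in> carrier_mat 2 2" and B: "B \<in> carrier_mat 2 2"
    and X: "X = U * diag_block_mat [A, 0\<^sub>m (n - 2) (n - 2)] * adj U"
    and Y: "Y = U * diag_block_mat [B, 0\<^sub>m (n - 2) (n - 2)] * adj U"
  shows "maximal_pair n X Y \<longleftrightarrow> maximal_pair 2 A B"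
proof -
  note U' = unitary_groupD[OF U]
  let ?D = "\<lambda>A. diag_block_mat [A, 0\<^sub>m (n - 2) (n - 2)] :: complex mat"
  have D: "?D A \<in> carrier_mat n n" if "A \<in> carrier_mat 2 2" for A
    unfolding corner_block[OF that n] by simp
  have conj: "fsq (U * M * adj U) = fsq M" if "M \<in> carrier_mat n n" for M
    using that U' by (simp add: fsq_unitary_left[OF U] fsq_unitary_right[OF adj_unitary[OF U]] del: assoc_mult_mat)
  have XY: "X \<in> carrier_mat n n" "Y \<in> carrier_mat n n" using D A B U' by (auto simp: X Y simp del: diag_block_mat.simps)
  have AB: "comm A B \<in> carrier_mat 2 2" using A B by auto
  have norms: "fsq X = fsq A" "fsq Y = fsq B"
    unfolding X Y using A B D n by (simp_all only: conj fsq_corner_block)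
  have "comm X Y = U * comm (?D A) (?D B) * adj U"
    unfolding X Y using D[OF A] D[OF B] U'
    by (simp add: sq_algebra[of _ n] unitary_cancel[OF U] del: diag_block_mat.simps)
  also have "\<dots> = U * ?D (comm A B) * adj U" unfolding comm_corner_block[OF A B n] ..
  finally have c: "fsq (comm X Y) = fsq (comm A B)" using D[OF AB] fsq_corner_block[OF AB n] by (simp only: conj)
  have nz: "X \<noteq> 0\<^sub>m n n \<longleftrightarrow> A \<noteq> 0\<^sub>m 2 2" "Y \<noteq> 0\<^sub>m n n \<longleftrightarrow> B \<noteq> 0\<^sub>m 2 2"
    unfolding fsq_pos_iff[OF XY(1), symmetric] fsq_pos_iff[OF XY(2), symmetric]
      fsq_pos_iff[OF A, symmetric] fsq_pos_iff[OF B, symmetric] norms by simp_all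
  show ?thesis
    unfolding maximal_pair_def nz norms c using XY A B by simp
qed

lemma permute_columns_unitary:
  assumes V: "V \<in> unitary_group n" and p: "bij_betw p {..<n} {..<n}"
  defines "U \<equiv> mat n n (\<lambda>(i, j). V $$ (i, p j))"
  shows "U \<in> unitary_group n"
    and "A \<in> carrier_mat n n \<Longrightarrow> i < n \<Longrightarrow> j < n \<Longrightarrow>
      (adj U * (A * U)) $$ (i, j) = (adj V * (A * V)) $$ (p i, p j)"
proof -
  note V' = unitary_groupD[OF V]
  have U: "U \<in> carrier_mat n n" by (simp add: U_def)
  have p_less: "p i < n" if "i < n" for i using p that by (auto simp: bij_betw_def)
  have entry: "(adj U * (A * U)) $$ (i, j) = (adj V * (A * V)) $$ (p i, p j)"
    if "A \<in> carrier_mat n n" "i < n" "j < n" for A i j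
    using that V' U p_less
    by (simp add: mult_entry_sum[of _ n n _ n] U_def del: index_mult_mat(1))
  then show "A \<in> carrier_mat n n \<Longrightarrow> i < n \<Longrightarrow> j < n \<Longrightarrow>
      (adj U * (A * U)) $$ (i, j) = (adj V * (A * V)) $$ (p i, p j)" .
  have "adj U * U = 1\<^sub>m n"
  proof (rule eq_matI)
    fix i j assume "i < dim_row (1\<^sub>m n :: complex mat)" "j < dim_col (1\<^sub>m n :: complex mat)"
    then have ij: "i < n" "j < n" by auto
    then have "(adj U * U) $$ (i, j) = (adj V * V) $$ (p i, p j)"
      using entry[of "1\<^sub>m n" i j] U V' left_mult_one_mat[OF U] left_mult_one_mat[OF V'(1)] by simp
    then show "(adj U * U) $$ (i, j) = 1\<^sub>m n $$ (i, j)"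
      unfolding V'(3) using ij p_less inj_on_eq_iff[OF bij_betw_imp_inj_on[OF p], of i j] by simp
  qed (use U in auto)
  then show "U \<in> unitary_group n" using U by (intro unitary_groupI)
qed

text \<open>The set \<open>K\<close> may have fewer than two elements; it is first enlarged to a set \<open>L\<close> with exactly two, which
  \<open>p\<close> moves to the front.\<close>

lemma ex_bij_first_two:
  assumes "K \<subseteq> {..<n}" "card K \<le> 2" "n \<ge> (2::nat)"
  obtains p where "bij_betw p {..<n} {..<n}" "\<And>i. i < n \<Longrightarrow> p i \<in> K \<Longrightarrow> i < 2"
proof -
  obtain L where L: "K \<subseteq> L" "L \<subseteq> {..<n}" "card L = 2"
    using exists_subset_between[of K 2 "{..<n}"] assms by auto
  have "finite L" using L finite_subset by blast
  then obtain f where f: "bij_betw f {..<2::nat} L"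
    using L(3) by (metis bij_betw_iff_card card_lessThan finite_lessThan)
  have "card ({..<n} - {..<2}) = card ({..<n} - L)"
    using L assms by (subst (1 2) card_Diff_subset) (auto simp: \<open>finite L\<close>)
  then obtain g where g: "bij_betw g ({..<n} - {..<2}) ({..<n} - L)"
    by (metis bij_betw_iff_card finite_Diff finite_lessThan)
  define p where "p i = (if i \<in> {..<2} then f i else g i)" for i
  have "bij_betw p ({..<2} \<union> ({..<n} - {..<2})) (L \<union> ({..<n} - L))"
    unfolding p_def by (rule bij_betw_disjoint_Un[OF f g]) auto
  moreover have "{..<2} \<union> ({..<n} - {..<2}) = {..<n}" "L \<union> ({..<n} - L) = {..<n}" using assms L by auto
  ultimately have "bij_betw p {..<n} {..<n}" by simp
  moreover have "i < 2" if "i < n" "p i \<in> K" for i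
  proof (rule ccontr)
    assume "\<not> i < 2"
    then have "p i \<in> {..<n} - L" using g that by (auto simp: p_def bij_betw_def)
    then show False using that L by auto
  qed
  ultimately show thesis using that by blast
qed

lemma supported_coord_projection_entry:
  assumes V: "V \<in> unitary_group n" and A: "A \<in> carrier_mat n n"
    and supp: "supported (coord_projection n V K) A" and ij: "i < n" "j < n" "\<not> (i \<in> K \<and> j \<in> K)"
  shows "(adj V * (A * V)) $$ (i, j) = 0"
proof -
  note V' = unitary_groupD[OF V]
  let ?D = "mat_diag n (\<lambda>i. of_bool (i \<in> K)) :: complex mat"
  define B where "B = adj V * (A * V)"
  have B: "B \<in> carrier_mat n n" using A V' by (simp add: B_def)
  have DB: "?D * B = adj V * ((coord_projection n V K * A) * V)"
    using A V' by (simp add: B_def coord_projection_def sq_algebra(1)[of _ n] unitary_cancel[OF V])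
  have BD: "B * ?D = adj V * ((A * coord_projection n V K) * V)"
    using A V' by (simp add: B_def coord_projection_def sq_algebra(1)[of _ n] unitary_cancel[OF V]
        right_mult_one_mat[of ?D n n])
  have fixed: "?D * B = B" "B * ?D = B" using supp unfolding DB BD by (simp_all add: supported_def B_def)
  have "(?D * B) $$ (i, j) = of_bool (i \<in> K) * B $$ (i, j)"
    "(B * ?D) $$ (i, j) = of_bool (j \<in> K) * B $$ (i, j)"
    using B ij(1,2) by (simp_all add: mat_diag_mult_left[of _ n n] mat_diag_mult_right[of _ n n] mult.commute)
  then have "B $$ (i, j) = of_bool (i \<in> K) * B $$ (i, j)" "B $$ (i, j) = of_bool (j \<in> K) * B $$ (i, j)"
    unfolding fixed by simp_all
  moreover have "i \<notin> K \<or> j \<notin> K" using ij(3) by blast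
  ultimately show ?thesis unfolding B_def[symmetric] by (metis mult_zero_left of_bool_eq(1))
qed

lemma supported_to_corner:
  assumes n: "n \<ge> 2" and V: "V \<in> unitary_group n" and K: "K \<subseteq> {..<n}" "card K \<le> 2"
  obtains U where "U \<in> unitary_group n"
    "\<And>A. A \<in> carrier_mat n n \<Longrightarrow> supported (coord_projection n V K) A \<Longrightarrow>
      \<exists>A0 \<in> carrier_mat 2 2. A = U * diag_block_mat [A0, 0\<^sub>m (n - 2) (n - 2)] * adj U"
proof -
  obtain p where p: "bij_betw p {..<n} {..<n}" and p2: "\<And>i. i < n \<Longrightarrow> p i \<in> K \<Longrightarrow> i < 2"
    using ex_bij_first_two[OF K n] by blast
  define U where "U = mat n n (\<lambda>(i, j). V $$ (i, p j))"
  note perm = permute_columns_unitary[OF V p, folded U_def]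
  note U' = unitary_groupD[OF perm(1)]
  show thesis
  proof (rule that[OF perm(1)])
    fix A assume A: "A \<in> carrier_mat n n" and supp: "supported (coord_projection n V K) A"
    define B where "B = adj U * (A * U)"
    define A0 where "A0 = mat 2 2 (\<lambda>(i, j). B $$ (i, j))"
    have A0: "A0 \<in> carrier_mat 2 2" by (simp add: A0_def)
    have B: "B \<in> carrier_mat n n" using A U' by (simp add: B_def)
    have zero: "B $$ (i, j) = 0" if ij: "i < n" "j < n" "\<not> (i < 2 \<and> j < 2)" for i j
    proof -
      have "p i < n" "p j < n" using p ij by (auto simp: bij_betw_def)
      then show ?thesis
        unfolding B_def perm(2)[OF A ij(1,2)]
        using p2 ij by (intro supported_coord_projection_entry[OF V A supp]) auto
    qed
    have "B = diag_block_mat [A0, 0\<^sub>m (n - 2) (n - 2)]"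
      unfolding corner_block[OF A0 n] using B zero by (intro eq_matI) (auto simp: A0_def)
    moreover have "U * B * adj U = A"
      using A U' by (simp add: B_def sq_algebra(1)[of _ n] unitary_cancel[OF perm(1)])
    ultimately show "\<exists>A0 \<in> carrier_mat 2 2. A = U * diag_block_mat [A0, 0\<^sub>m (n - 2) (n - 2)] * adj U"
      using A0 by metis
  qed
qed

theorem corollary3p3:
  fixes n :: nat and X Y :: "complex mat"
  assumes "n \<ge> 2"
    and "X \<in> carrier_mat n n" and "Y \<in> carrier_mat n n"
    and "X \<noteq> 0\<^sub>m n n" and "Y \<noteq> 0\<^sub>m n n"
  shows "(maximal_pair n X Y \<longleftrightarrow>
           (\<exists>U X\<^sub>0 Y\<^sub>0. U \<in> unitary_group n \<and> maximal_pair 2 X\<^sub>0 Y\<^sub>0 \<and>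
              X = U * diag_block_mat [X\<^sub>0, 0\<^sub>m (n - 2) (n - 2)] * mat_adjoint U \<and>
              Y = U * diag_block_mat [Y\<^sub>0, 0\<^sub>m (n - 2) (n - 2)] * mat_adjoint U))
       \<and> (\<forall>X\<^sub>0 \<in> carrier_mat 2 2. \<forall>Y\<^sub>0 \<in> carrier_mat 2 2.
            maximal_pair 2 X\<^sub>0 Y\<^sub>0 \<longleftrightarrow>
              X\<^sub>0 \<noteq> 0\<^sub>m 2 2 \<and> Y\<^sub>0 \<noteq> 0\<^sub>m 2 2 \<and>
              mat_trace (X\<^sub>0 * mat_adjoint Y\<^sub>0) = 0 \<and> mat_trace X\<^sub>0 = 0 \<and> mat_trace Y\<^sub>0 = 0)"
proof (intro conjI ballI)
  show "maximal_pair n X Y \<longleftrightarrow>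
           (\<exists>U X\<^sub>0 Y\<^sub>0. U \<in> unitary_group n \<and> maximal_pair 2 X\<^sub>0 Y\<^sub>0 \<and>
              X = U * diag_block_mat [X\<^sub>0, 0\<^sub>m (n - 2) (n - 2)] * mat_adjoint U \<and>
              Y = U * diag_block_mat [Y\<^sub>0, 0\<^sub>m (n - 2) (n - 2)] * mat_adjoint U)"
    (is "_ = ?R")
  proof
    assume max: "maximal_pair n X Y"
    then have "fsq (comm X Y) = 2 * fsq X * fsq Y" by (simp add: maximal_pair_def)
    then obtain V K where VK: "V \<in> unitary_group n" "K \<subseteq> {..<n}" "card K \<le> 2"
      "supported (coord_projection n V K) X" "supported (coord_projection n V K) Y"
      using maximal_common_support[OF assms(2-5)] by blast
    obtain U where U: "U \<in> unitary_group n"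
      "\<And>A. A \<in> carrier_mat n n \<Longrightarrow> supported (coord_projection n V K) A \<Longrightarrow>
        \<exists>A0 \<in> carrier_mat 2 2. A = U * diag_block_mat [A0, 0\<^sub>m (n - 2) (n - 2)] * adj U"
      using supported_to_corner[OF assms(1) VK(1-3)] by blast
    obtain X\<^sub>0 where X0: "X\<^sub>0 \<in> carrier_mat 2 2" "X = U * diag_block_mat [X\<^sub>0, 0\<^sub>m (n - 2) (n - 2)] * adj U"
      using U(2)[OF assms(2) VK(4)] by blast
    obtain Y\<^sub>0 where Y0: "Y\<^sub>0 \<in> carrier_mat 2 2" "Y = U * diag_block_mat [Y\<^sub>0, 0\<^sub>m (n - 2) (n - 2)] * adj U"
      using U(2)[OF assms(3) VK(5)] by blast
    have "maximal_pair 2 X\<^sub>0 Y\<^sub>0"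
      using maximal_pair_corner[OF assms(1) U(1) X0(1) Y0(1) X0(2) Y0(2)] max by blast
    then show ?R using U(1) X0(2) Y0(2) by blast
  next
    assume ?R
    then obtain U X\<^sub>0 Y\<^sub>0 where R: "U \<in> unitary_group n" "maximal_pair 2 X\<^sub>0 Y\<^sub>0"
      "X = U * diag_block_mat [X\<^sub>0, 0\<^sub>m (n - 2) (n - 2)] * adj U"
      "Y = U * diag_block_mat [Y\<^sub>0, 0\<^sub>m (n - 2) (n - 2)] * adj U" by blast
    then show "maximal_pair n X Y"
      using maximal_pair_corner[OF assms(1) R(1) _ _ R(3,4)] by (simp add: maximal_pair_def)
  qed
  show "maximal_pair 2 X\<^sub>0 Y\<^sub>0 \<longleftrightarrow> X\<^sub>0 \<noteq> 0\<^sub>m 2 2 \<and> Y\<^sub>0 \<noteq> 0\<^sub>m 2 2 \<and>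
      mat_trace (X\<^sub>0 * mat_adjoint Y\<^sub>0) = 0 \<and> mat_trace X\<^sub>0 = 0 \<and> mat_trace Y\<^sub>0 = 0"
    if "X\<^sub>0 \<in> carrier_mat 2 2" "Y\<^sub>0 \<in> carrier_mat 2 2" for X\<^sub>0 Y\<^sub>0
    using maximal_pair_2_iff[OF that] .
qed

end
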